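(* Let $n\in\{2,3\}$, let $\Gamma\subset\Gamma_\infty$ be a nonempty bounded relatively open set with $L:=\operatorname{diam}\Gamma$, and let $c_0>0$. Let $\beta=-2/3$ if $n=3$ and $\beta=-1/2$ if $n=2$. Then there is a constant $C>0$ depending only on $c_0$ (and $n$) such that the sesquilinear form $a_{\mathsf N}(\phi,\psi):=\langle T_k\phi,\psi\rangle_{H^{-1/2}(\Gamma)\times\tilde H^{1/2}(\Gamma)}$ on $\tilde H^{1/2}(\Gamma)\times\tilde H^{1/2}(\Gamma)$ satisfies $$|a_{\mathsf N}(\phi,\phi)|\ge C(kL)^{\beta}\|\phi\|^2_{\tilde H^{1/2}_k(\Gamma)}\qquad\text{for all }\phi\in\tilde H^{1/2}(\Gamma)\text{ and all }k>0\text{ with }kL\ge c_0.$$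
   Context: $\Gamma_\infty:=\{\mathbf{x}\in\mathbb{R}^n:x_n=0\}$ is identified with $\mathbb{R}^{n-1}$ and $\Gamma$ with the corresponding open subset of $\mathbb{R}^{n-1}$; $\mathscr{D}(\Gamma)=C_0^\infty(\Gamma)$. Fourier transform: $\hat u(\boldsymbol{\xi})=(2\pi)^{-(n-1)/2}\int e^{-{\mathrm{i}}\boldsymbol{\xi}\cdot\mathbf{x}}u(\mathbf{x})\,\mathrm{d}\mathbf{x}$. For $s\in\mathbb{R}$, $\|u\|_{H^s_k(\mathbb{R}^{n-1})}^2=\int(k^2+|\boldsymbol{\xi}|^2)^s|\hat u(\boldsymbol{\xi})|^2\,\mathrm{d}\boldsymbol{\xi}$; $H^s(\Gamma)$ = restrictions to $\Gamma$ of elements of $H^s(\mathbb{R}^{n-1})$ with the infimum-over-extensions norm; $\tilde H^s(\Gamma)$ = closure of $\mathscr{D}(\Gamma)$ in $H^s(\mathbb{R}^{n-1})$ with norm $\|\cdot\|_{\tilde H^s_k(\Gamma)}:=\|\cdot\|_{H^s_k(\mathbb{R}^{n-1})}$. Duality pairing: $\langle u,v\rangle_{H^{-1/2}(\Gamma)\times\tilde H^{1/2}(\Gamma)}:=\int\hat U(\boldsymbol{\xi})\overline{\hat v(\boldsymbol{\xi})}\,\mathrm{d}\boldsymbol{\xi}$ for any extension $U\in H^{-1/2}(\mathbb{R}^{n-1})$ of $u$. $T_k:\tilde H^{1/2}(\Gamma)\to H^{-1/2}(\Gamma)$ is the hypersingular operator: the bounded extension of $\phi\mapsto(T_k^\infty\phi)|_\Gamma$,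 $\phi\in\mathscr{D}(\Gamma)$, where $\widehat{T_k^\infty\phi}(\boldsymbol{\xi})=\frac{{\mathrm{i}}}{2}Z(\boldsymbol{\xi})\hat\phi(\boldsymbol{\xi})$ and $Z(\boldsymbol{\xi})=\sqrt{k^2-|\boldsymbol{\xi}|^2}$ for $|\boldsymbol{\xi}|\le k$, ${\mathrm{i}}\sqrt{|\boldsymbol{\xi}|^2-k^2}$ for $|\boldsymbol{\xi}|>k$ (this coincides with the normal derivative on $\Gamma$ of the double-layer potential $\int_\Gamma\partial_{y_n}\Phi(\mathbf{x},\mathbf{y})\phi(\mathbf{y})\,\mathrm{d}s(\mathbf{y})$, $\Phi$ the Helmholtz fundamental solution). *)

theory Defs
  imports "HOL-Analysis.Analysis"
begin

text \<open>Gamma_infinity is identified with real^'d, d = n - 1.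
  Partial derivative of a complex-valued function along coordinate i.\<close>

definition pdiff :: "'d::finite \<Rightarrow> (real^'d \<Rightarrow> complex) \<Rightarrow> real^'d \<Rightarrow> complex" where
  "pdiff i f x = vector_derivative (\<lambda>t. f (x + t *\<^sub>R axis i 1)) (at 0)"

fun iter_pdiff :: "'d::finite list \<Rightarrow> (real^'d \<Rightarrow> complex) \<Rightarrow> real^'d \<Rightarrow> complex" where
  "iter_pdiff [] f = f"
| "iter_pdiff (i # is) f = pdiff i (iter_pdiff is f)"

definition smooth_fun :: "(real^'d::finite \<Rightarrow> complex) \<Rightarrow> bool" where
  "smooth_fun f \<longleftrightarrow> (\<forall>is. continuous_on UNIV (iter_pdiff is f) \<and>
      (\<forall>i x. (\<lambda>t. iter_pdiff is f (x + t *\<^sub>R axis i 1)) differentiable (at 0)))"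

definition test_fun :: "(real^'d::finite) set \<Rightarrow> (real^'d \<Rightarrow> complex) set" where
  "test_fun \<Gamma> = {\<phi>. smooth_fun \<phi> \<and> compact (closure {x. \<phi> x \<noteq> 0}) \<and>
                      closure {x. \<phi> x \<noteq> 0} \<subseteq> \<Gamma>}"

definition fourier :: "(real^'d::finite \<Rightarrow> complex) \<Rightarrow> real^'d \<Rightarrow> complex" where
  "fourier u \<xi> = complex_of_real ((2 * pi) powr (- real CARD('d) / 2)) *
      (LINT x|lborel. exp (- \<i> * complex_of_real (\<xi> \<bullet> x)) * u x)"

text \<open>Elements of H^s(R^(n-1)) are represented by their Fourier transforms U = \<hat>u.
  Squared k-weighted norm ||u||^2_{H^s_k}.\<close>
definition hnorm2 :: "real \<Rightarrow> real \<Rightarrow> (real^'d::finite \<Rightarrow> complex) \<Rightarrow> real" where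
  "hnorm2 s k U = (LINT \<xi>|lborel. (k\<^sup>2 + (norm \<xi>)\<^sup>2) powr s * (cmod (U \<xi>))\<^sup>2)"

definition in_H :: "real \<Rightarrow> (real^'d::finite \<Rightarrow> complex) \<Rightarrow> bool" where
  "in_H s U \<longleftrightarrow> U \<in> borel_measurable lborel \<and>
     integrable lborel (\<lambda>\<xi>. (1 + (norm \<xi>)\<^sup>2) powr s * (cmod (U \<xi>))\<^sup>2)"

definition Htilde :: "real \<Rightarrow> (real^'d::finite) set \<Rightarrow> (real^'d \<Rightarrow> complex) set" where
  "Htilde s \<Gamma> = {U. in_H s U \<and> (\<exists>\<phi>::nat \<Rightarrow> real^'d \<Rightarrow> complex. (\<forall>j. \<phi> j \<in> test_fun \<Gamma>) \<and>
        (\<lambda>j. hnorm2 s 1 (\<lambda>\<xi>. U \<xi> - fourier (\<phi> j) \<xi>)) \<longlonglongrightarrow> 0)}"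

definition Zsym :: "real \<Rightarrow> real^'d::finite \<Rightarrow> complex" where
  "Zsym k \<xi> = (if norm \<xi> \<le> k then complex_of_real (sqrt (k\<^sup>2 - (norm \<xi>)\<^sup>2))
               else \<i> * complex_of_real (sqrt ((norm \<xi>)\<^sup>2 - k\<^sup>2)))"

text \<open>a_N(phi,psi) = <T_k phi, psi>, computed with the canonical extension
  U = T_k^infinity phi of T_k phi, whose Fourier transform is (i/2) Z \<hat>phi.\<close>
definition aN :: "real \<Rightarrow> (real^'d::finite \<Rightarrow> complex) \<Rightarrow> (real^'d \<Rightarrow> complex) \<Rightarrow> complex" where
  "aN k U V = (LINT \<xi>|lborel. (\<i> / 2 * Zsym k \<xi> * U \<xi>) * cnj (V \<xi>))"

end

theory Submission
  imports Defs "HOL-Probability.Levy"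
begin

text \<open>If \<open>\<phi>\<close> is supported in a set of diameter \<open>L\<close>, then on every line parallel to a coordinate axis
  \<open>|\<phi>^|\<^sup>2\<close> at a point is at most a constant times \<open>L\<close> times its integral over the line. Integrating this
  over a set that meets each such line in length at most \<open>\<delta>\<close> shows that the set carries at most a fraction
  of order \<open>L \<delta>\<close> of the mass of \<open>|\<phi>^|\<^sup>2\<close>. The annulus \<open>||\<xi>| - k| \<le> w\<close> is a finite union of
  such sets with \<open>\<delta>\<close> of order \<open>w\<close>, so for \<open>w = \<theta> / L\<close> with \<open>\<theta>\<close> small it carries at most half
  of the mass. Outside the annulus \<open>|Z|\<close> is at least a constant times \<open>sqrt (w / k)\<close> times the
  \<open>H\<^sup>1\<^sup>/\<^sup>2\<close> weight, and \<open>|a + \<i> b| \<ge> (a + b) / 2\<close> for \<open>a, b \<ge> 0\<close> bounds \<open>|a\<^sub>N|\<close> from below by the integral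
  of \<open>|Z| |\<phi>^|\<^sup>2\<close>. This gives the exponent \<open>-1/2\<close> in every dimension, which is stronger than
  \<open>-2/3\<close> because \<open>k L\<close> is bounded below.\<close>

section \<open>A band-limiting kernel\<close>

text \<open>The interval is symmetric about 0, so the two endpoint exponentials combine into a real
  sine. It supplies the factor \<open>sin (3 * t / 2)\<close> of the kernel below; the factor
  \<open>sin (t / 2)\<close> comes from the window of length 1 in Levy inversion.\<close>

lemma char_uniform_measure:
  assumes "t \<noteq> 0"
  shows "char (uniform_measure lborel {-3/2..3/2}) t = of_real (2 * sin (3 * t / 2) / (3 * t))"
proof -
  let ?I = "{-3/2..3/2::real}"
  have "char (uniform_measure lborel ?I) t = (LINT x|lborel. (indicator ?I x / 3) *\<^sub>R iexp (t * x))"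
  proof -
    have *: "(\<lambda>x. indicator ?I x / emeasure lborel ?I) = (\<lambda>x. ennreal (indicator ?I x / 3))"
      by (auto simp: fun_eq_iff indicator_def divide_ennreal[symmetric])
    show ?thesis
      unfolding char_def uniform_measure_def *
      by (subst integral_density) auto
  qed
  also have "\<dots> = (LINT x|lborel. indicator ?I x *\<^sub>R (iexp (t * x) / 3))"
    by (intro Bochner_Integration.integral_cong) (auto simp: scaleR_conv_of_real)
  also have "\<dots> = iexp (t * (3/2)) / (3 * \<i> * t) - iexp (t * (-3/2)) / (3 * \<i> * t)"
    using assms
    by (intro integral_FTC_atLeastAtMost)
       (auto intro!: derivative_eq_intros continuous_intros
             simp: field_simps has_vector_derivative_complex_iff Re_exp Im_exp Re_divide Im_divide power2_eq_square)
  also have "\<dots> = of_real (2 * sin (3 * t / 2) / (3 * t))"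
    using assms by (auto simp: complex_eq_iff Re_exp Im_exp Re_divide Im_divide power2_eq_square field_simps)
  finally show ?thesis .
qed

text \<open>The inverse Fourier transform of the trapezoid that equals 1 on \<open>[-1, 1]\<close> and vanishes outside
  \<open>[-2, 2]\<close>. At \<open>x\<close> the trapezoid is 3 times the mass that the uniform distribution on \<open>[-3/2, 3/2]\<close>
  gives to \<open>(x - 1/2, x + 1/2]\<close>, so its Fourier integral is an instance of Levy inversion.\<close>
definition trapezoid_kernel :: "real \<Rightarrow> real" where
  "trapezoid_kernel t = 2 / pi * sin (t / 2) * sin (3 * t / 2) / t\<^sup>2"

text \<open>Near 0 the two sines cancel \<open>t\<^sup>2\<close>; away from 0 they are at most 1.
  The single majorant yields integrability both of the kernel, for Fubini, and of its square, for
  Cauchy-Schwarz.\<close>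

lemma trapezoid_kernel_bound: "\<bar>trapezoid_kernel t\<bar> \<le> 4 / (1 + t\<^sup>2)"
proof (cases "\<bar>t\<bar> \<le> 1")
  case True
  have "\<bar>sin (t / 2)\<bar> * \<bar>sin (3 * t / 2)\<bar> \<le> (\<bar>t\<bar> / 2) * (3 * \<bar>t\<bar> / 2)"
    using abs_sin_x_le_abs_x[of "t/2"] abs_sin_x_le_abs_x[of "3*t/2"]
    by (intro mult_mono) auto
  also have "\<dots> = 3/4 * t\<^sup>2"
    by (simp add: power2_eq_square)
  finally have *: "\<bar>sin (t / 2)\<bar> * \<bar>sin (3 * t / 2)\<bar> \<le> 3/4 * t\<^sup>2" .
  have "\<bar>trapezoid_kernel t\<bar> = 2 / pi * (\<bar>sin (t / 2)\<bar> * \<bar>sin (3 * t / 2)\<bar> / t\<^sup>2)"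
    by (simp add: trapezoid_kernel_def abs_mult)
  also have "\<dots> \<le> 1 * (3/4)"
    using * pi_gt3 by (intro mult_mono) (auto simp: divide_simps)
  also have "\<dots> \<le> 4 / (1 + t\<^sup>2)"
    using abs_square_le_1[of t] True add_pos_nonneg[of 1 "t\<^sup>2"] by (simp add: field_simps)
  finally show ?thesis .
next
  case False
  then have t: "t\<^sup>2 \<ge> 1"
    by (metis abs_square_le_1 linorder_le_cases)
  have *: "\<bar>sin (t / 2)\<bar> * \<bar>sin (3 * t / 2)\<bar> \<le> 1 * 1"
    by (intro mult_mono) auto
  have "\<bar>trapezoid_kernel t\<bar> = 2 / pi * (\<bar>sin (t / 2)\<bar> * \<bar>sin (3 * t / 2)\<bar> / t\<^sup>2)"
    by (simp add: trapezoid_kernel_def abs_mult)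
  also have "\<dots> \<le> 1 * (1 / t\<^sup>2)"
    using * pi_gt3 t by (intro mult_mono divide_right_mono) (auto simp: divide_simps)
  also have "\<dots> \<le> 4 / (1 + t\<^sup>2)"
  proof -
    have "0 < t\<^sup>2" "0 < 1 + t\<^sup>2"
      using t by linarith+
    then show ?thesis
      using t by (simp add: divide_simps)
  qed
  finally show ?thesis .
qed

lemma trapezoid_kernel_measurable [measurable]: "trapezoid_kernel \<in> borel_measurable borel"
  unfolding trapezoid_kernel_def by measurable

lemma integrable_inverse_square: "integrable lborel (\<lambda>t::real. 1 / (1 + t\<^sup>2))"
  using integrable_inverse_1_plus_square
  by (simp add: set_integrable_def einterval_def inverse_eq_divide)

lemma integrable_trapezoid_kernel: "integrable lborel trapezoid_kernel"
proof (rule Bochner_Integration.integrable_bound)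
  show "integrable lborel (\<lambda>t::real. 4 * (1 / (1 + t\<^sup>2)))"
    by (intro integrable_mult_right integrable_inverse_square)
  show "AE t in lborel. norm (trapezoid_kernel t) \<le> norm (4 * (1 / (1 + t\<^sup>2)))"
    using trapezoid_kernel_bound by (simp add: abs_divide add_nonneg_nonneg)
qed measurable

lemma integrable_trapezoid_kernel_square: "integrable lborel (\<lambda>t. (trapezoid_kernel t)\<^sup>2)"
proof (rule Bochner_Integration.integrable_bound[where f="\<lambda>t. 16 * (1 / (1 + t\<^sup>2))"])
  show "integrable lborel (\<lambda>t::real. 16 * (1 / (1 + t\<^sup>2)))"
    by (intro integrable_mult_right integrable_inverse_square)
  have "(trapezoid_kernel t)\<^sup>2 \<le> 16 * (1 / (1 + t\<^sup>2))" for t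
  proof -
    have "(trapezoid_kernel t)\<^sup>2 \<le> (4 / (1 + t\<^sup>2))\<^sup>2"
      using trapezoid_kernel_bound[of t] by (intro power2_le_iff_abs_le[THEN iffD2]) auto
    also have "\<dots> = 16 * (1 / (1 + t\<^sup>2)) * (1 / (1 + t\<^sup>2))"
      by (simp add: power2_eq_square)
    also have "\<dots> \<le> 16 * (1 / (1 + t\<^sup>2)) * 1"
      by (intro mult_left_mono) (auto simp: add_pos_nonneg)
    finally show ?thesis by simp
  qed
  then show "AE t in lborel. norm ((trapezoid_kernel t)\<^sup>2) \<le> norm (16 * (1 / (1 + t\<^sup>2)))"
    by (simp add: abs_divide add_nonneg_nonneg)
qed measurable

lemma fourier_trapezoid_kernel:
  assumes "\<bar>x\<bar> \<le> 1"
  shows "(LINT t|lborel. of_real (trapezoid_kernel t) * iexp (- (t * x))) = 1"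
proof -
  define M where "M = uniform_measure lborel {-3/2..3/2::real}"
  interpret prob_space M
    unfolding M_def by (rule prob_space_uniform_measure) auto
  interpret real_distribution M
    by standard (auto simp: M_def)
  let ?a = "x - 1/2" and ?b = "x + 1/2"
  let ?F = "\<lambda>t. (iexp (- (t * ?a)) - iexp (- (t * ?b))) / (\<i> * t) * char M t"
  let ?K = "\<lambda>t. complex_of_real (trapezoid_kernel t) * iexp (- (t * x))"
  \<comment> \<open>The difference of exponentials over a window of length 1 is a modulated
    \<open>sin (t / 2)\<close>, so the Levy integrand is a multiple of the kernel. The point 0,
    where both are quotients by 0, is discarded below as a null set.\<close>
  have F: "?F t = (2 * pi / 3) * ?K t" if "t \<noteq> 0" for t
  proof -
    have "iexp (- (t * ?a)) - iexp (- (t * ?b)) = iexp (- (t * x)) * (iexp (t / 2) - iexp (- (t / 2)))"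
      by (simp add: algebra_simps flip: exp_add)
    also have "iexp (t / 2) - iexp (- (t / 2)) = 2 * \<i> * sin (t / 2)"
      by (simp add: complex_eq_iff Re_exp Im_exp)
    finally show ?thesis
      unfolding M_def char_uniform_measure[OF that] using that
      by (simp add: trapezoid_kernel_def field_simps power2_eq_square)
  qed
  have intK: "integrable lborel ?K"
    by (rule Bochner_Integration.integrable_bound[OF integrable_trapezoid_kernel]) (auto simp: norm_mult)
  have "(\<lambda>T::nat. 1 / (2 * pi) * (CLBINT t=-T..T. ?F t)) \<longlonglongrightarrow> measure M {?a<..?b}"
  proof (rule Levy_Inversion)
    have "measure lborel (A \<inter> {y}) = 0" for A and y :: real
      by (cases "y \<in> A") auto
    then show "measure M {?a} = 0" "measure M {?b} = 0"
      by (simp_all add: M_def)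
  qed simp
  \<comment> \<open>For \<bar>x\<bar> \<le> 1 the whole window lies in the support of the uniform
    distribution: this is the plateau of the trapezoid.\<close>
  also have "measure M {?a<..?b} = 1/3"
  proof -
    have "{-3/2..3/2} \<inter> {?a<..?b} = {?a<..?b}"
      using assms by auto
    then show ?thesis
      by (simp add: M_def)
  qed
  also have "(\<lambda>T::nat. 1 / (2 * pi) * (CLBINT t=-T..T. ?F t)) =
      (\<lambda>T::nat. (1/3) * (LINT t|lborel. indicator {-real T..real T} t *\<^sub>R ?K t))"
  proof
    fix T :: nat
    have "(CLBINT t=-T..T. ?F t) = (LINT t:{-real T..real T}|lborel. ?F t)"
      using interval_integral_Icc[of "- real T" "real T" ?F] by simp
    also have "\<dots> = (LINT t:{-real T..real T}|lborel. (2 * pi / 3) * ?K t)"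
      using F AE_lborel_singleton[of "0::real"]
      by (intro set_lebesgue_integral_cong_AE) (auto elim!: eventually_mono)
    also have "\<dots> = (2 * pi / 3) * (LINT t|lborel. indicator {-real T..real T} t *\<^sub>R ?K t)"
      by (simp add: set_lebesgue_integral_def)
    finally show "1 / (2 * pi) * (CLBINT t=-T..T. ?F t) =
      (1/3) * (LINT t|lborel. indicator {-real T..real T} t *\<^sub>R ?K t)"
      by simp
  qed
  finally have 1: "(\<lambda>T::nat. (1/3) * (LINT t|lborel. indicator {-real T..real T} t *\<^sub>R ?K t)) \<longlonglongrightarrow> of_real (1/3)" .
  \<comment> \<open>Levy inversion gives only a limit of truncated integrals; dominated convergence
    identifies it with the full integral because the kernel is integrable.\<close>
  have "(\<lambda>T::nat. LINT t|lborel. indicator {-real T..real T} t *\<^sub>R ?K t) \<longlonglongrightarrow> (LINT t|lborel. ?K t)"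
  proof (rule integral_dominated_convergence[where w="\<lambda>t. norm (?K t)"])
    show "AE t in lborel. (\<lambda>T. indicator {-real T..real T} t *\<^sub>R ?K t) \<longlonglongrightarrow> ?K t"
    proof (rule AE_I2, rule tendsto_eventually)
      fix t :: real
      obtain N :: nat where "\<bar>t\<bar> \<le> N" using real_arch_simple by blast
      then show "\<forall>\<^sub>F T in sequentially. indicator {-real T..real T} t *\<^sub>R ?K t = ?K t"
        by (intro eventually_sequentiallyI[of N]) (auto simp: indicator_def)
    qed
  qed (use intK in \<open>auto simp: indicator_def\<close>)
  then have "(\<lambda>T::nat. (1/3) * (LINT t|lborel. indicator {-real T..real T} t *\<^sub>R ?K t)) \<longlonglongrightarrow> (1/3) * (LINT t|lborel. ?K t)"
    by (intro tendsto_intros)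
  from LIMSEQ_unique[OF this 1] show ?thesis
    by simp
qed

section \<open>Bounds along lines\<close>

lemma fourier_measurable [measurable]:
  fixes f :: "real^'d::finite \<Rightarrow> complex"
  assumes [measurable]: "f \<in> borel_measurable borel"
  shows "fourier f \<in> borel_measurable borel"
proof -
  have "(\<lambda>(\<xi>::real^'d, x). exp (- \<i> * complex_of_real (\<xi> \<bullet> x)) * f x) \<in> borel_measurable (borel \<Otimes>\<^sub>M lborel)"
    by measurable
  then have "(\<lambda>\<xi>::real^'d. LINT x|lborel. exp (- \<i> * complex_of_real (\<xi> \<bullet> x)) * f x) \<in> borel_measurable borel"
    by (rule lborel.borel_measurable_lebesgue_integral)
  then show ?thesis
    unfolding fourier_def[abs_def] by measurable
qed

text \<open>A reproducing formula. In the scaled coordinate \<open>(x $ i - p) / L\<close> the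
  support of \<open>f\<close> lies in [-1, 1], where the trapezoid is 1, so multiplying
  \<open>f\<close> by it changes nothing; on the Fourier side this multiplication is a convolution
  along the axis \<open>i\<close>. The factor \<open>iexp (t * p)\<close> centres the trapezoid at
  \<open>p\<close>.\<close>

lemma fourier_line_representation:
  fixes f :: "real^'d::finite \<Rightarrow> complex"
  assumes f: "integrable lborel f"
    and supp: "{x. f x \<noteq> 0} \<subseteq> {x. \<bar>x $ i - p\<bar> \<le> L}"
    and L: "L > 0"
  defines "\<kappa> \<equiv> \<lambda>t. complex_of_real (L * trapezoid_kernel (L * t)) * iexp (t * p)"
  shows "integrable lborel (\<lambda>t. \<kappa> t * fourier f (\<xi> + t *\<^sub>R axis i 1))"
    and "fourier f \<xi> = (LINT t|lborel. \<kappa> t * fourier f (\<xi> + t *\<^sub>R axis i 1))"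
proof -
  define c where "c = complex_of_real ((2 * pi) powr (- real CARD('d) / 2))"
  let ?e = "\<lambda>x. exp (- \<i> * complex_of_real (\<xi> \<bullet> x))"
  let ?G = "\<lambda>x t. \<kappa> t * (?e x * iexp (- (t * (x $ i))) * f x)"
  have [measurable]: "f \<in> borel_measurable borel"
    using borel_measurable_integrable[OF f] by simp
  have [measurable]: "\<kappa> \<in> borel_measurable borel"
    unfolding \<kappa>_def by measurable
  have [measurable]: "(\<lambda>x::real^'d. x $ i) \<in> borel_measurable borel"
    by (intro borel_measurable_continuous_onI continuous_intros)
  have norm_\<kappa>: "norm (\<kappa> t) = norm (L * trapezoid_kernel (L * t))" for t
    using L by (simp add: \<kappa>_def norm_mult abs_mult)
  have "integrable lborel (\<lambda>t. L * trapezoid_kernel (0 + L * t))"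
    using L by (intro integrable_mult_right lborel_integrable_real_affine integrable_trapezoid_kernel) auto
  then have int_\<kappa>: "integrable lborel \<kappa>"
    by (rule Bochner_Integration.integrable_bound) (auto simp: norm_\<kappa>)
  have norm_G: "norm (?G x t) = norm (f x) * norm (\<kappa> t)" for x t
    by (simp add: norm_mult)
  have int_t: "integrable lborel (?G x)" for x
    by (rule Bochner_Integration.integrable_bound[where f="\<lambda>t. norm (f x) * norm (\<kappa> t)"])
       (use int_\<kappa> in \<open>auto simp: norm_G norm_mult\<close>)
  \<comment> \<open>The norm of the integrand is the product of a function of \<open>x\<close> and a
    function of \<open>t\<close>, both integrable.\<close>
  have int_G: "integrable (lborel \<Otimes>\<^sub>M lborel) (case_prod ?G)"
  proof (rule lborel_pair.Fubini_integrable)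
    show "integrable lborel (\<lambda>x. LINT t|lborel. norm (case_prod ?G (x, t)))"
      unfolding prod.case norm_G using f by simp
  qed (use int_t in auto)
  have inner: "(LINT t|lborel. ?G x t) = ?e x * f x" for x
  proof (cases "f x = 0")
    case False
    define y where "y = (x $ i - p) / L"
    have y: "\<bar>y\<bar> \<le> 1" "L * y = x $ i - p"
      using supp False L by (auto simp: y_def)
    have "1 = (LINT t|lborel. of_real (trapezoid_kernel t) * iexp (- (t * y)))"
      using fourier_trapezoid_kernel[OF y(1)] by simp
    also have "\<dots> = L * (LINT t|lborel. of_real (trapezoid_kernel (L * t)) * iexp (- (L * t * y)))"
      using L by (subst lborel_integral_real_affine[where c=L and t=0]) (auto simp: scaleR_conv_of_real)
    also have "\<dots> = (LINT t|lborel. L * (of_real (trapezoid_kernel (L * t)) * iexp (- (L * t * y))))"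
      by simp
    also have "\<dots> = (LINT t|lborel. \<kappa> t * iexp (- (t * (x $ i))))"
    proof (rule Bochner_Integration.integral_cong)
      fix t :: real
      have "- (L * t * y) = t * p + - (t * (x $ i))"
        using y(2) by (metis (no_types, opaque_lifting) add.commute minus_diff_eq mult.assoc mult.commute right_diff_distrib uminus_add_conv_diff)
      then have "iexp (- (L * t * y)) = iexp (t * p) * iexp (- (t * (x $ i)))"
        by (simp add: distrib_left right_diff_distrib exp_diff exp_minus divide_inverse)
      then show "L * (of_real (trapezoid_kernel (L * t)) * iexp (- (L * t * y))) = \<kappa> t * iexp (- (t * (x $ i)))"
        by (simp add: \<kappa>_def)
    qed simp
    finally have "1 = (LINT t|lborel. \<kappa> t * iexp (- (t * (x $ i))))" .
    then have "?e x * f x = (LINT t|lborel. (?e x * f x) * (\<kappa> t * iexp (- (t * (x $ i)))))"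
      by (simp del: of_real_mult)
    then show ?thesis
      by (simp add: mult_ac)
  qed simp
  \<comment> \<open>Shifting the frequency by \<open>t\<close> along the axis multiplies the
    integrand by \<open>iexp (- (t * (x $ i)))\<close>.\<close>
  have snd: "(LINT x|lborel. ?G x t) * c = \<kappa> t * fourier f (\<xi> + t *\<^sub>R axis i 1)" for t
  proof -
    have "fourier f (\<xi> + t *\<^sub>R axis i 1) = c * (LINT x|lborel. ?e x * iexp (- (t * (x $ i))) * f x)"
      unfolding fourier_def c_def
      by (simp add: inner_add_left inner_axis' distrib_left exp_add exp_diff exp_minus field_simps)
    then show ?thesis by simp
  qed
  show "integrable lborel (\<lambda>t. \<kappa> t * fourier f (\<xi> + t *\<^sub>R axis i 1))"
    using lborel_pair.integrable_snd[OF int_G] by (simp flip: snd)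
  have "fourier f \<xi> = (LINT x|lborel. (LINT t|lborel. ?G x t)) * c"
    unfolding inner fourier_def c_def by (rule mult.commute)
  also have "(LINT x|lborel. (LINT t|lborel. ?G x t)) = (LINT t|lborel. (LINT x|lborel. ?G x t))"
    by (rule lborel_pair.Fubini_integral[OF int_G, symmetric])
  also have "\<dots> * c = (LINT t|lborel. \<kappa> t * fourier f (\<xi> + t *\<^sub>R axis i 1))"
    by (simp flip: snd)
  finally show "fourier f \<xi> = (LINT t|lborel. \<kappa> t * fourier f (\<xi> + t *\<^sub>R axis i 1))" .
qed

text \<open>The constant that Cauchy-Schwarz produces. By
  \<open>integrable_trapezoid_kernel_square\<close> it is a genuine integral and not the default
  value 0.\<close>

definition kernel_energy :: real where
  "kernel_energy = (LINT t|lborel. (trapezoid_kernel t)\<^sup>2)"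

lemma kernel_energy_nonneg: "kernel_energy \<ge> 0"
  by (simp add: kernel_energy_def)

text \<open>Cauchy-Schwarz in the reproducing formula. The rescaled kernel has squared norm
  \<open>L * kernel_energy\<close>, which is where the factor \<open>L\<close> arises. In
  \<open>ennreal\<close> the integral over a single line may be infinite.\<close>

lemma fourier_line_bound:
  fixes f :: "real^'d::finite \<Rightarrow> complex"
  assumes f: "integrable lborel f"
    and supp: "{x. f x \<noteq> 0} \<subseteq> {x. \<bar>x $ i - p\<bar> \<le> L}"
    and L: "L > 0"
  shows "ennreal ((cmod (fourier f \<xi>))\<^sup>2) \<le>
    ennreal (kernel_energy * L) * (\<integral>\<^sup>+t. ennreal ((cmod (fourier f (\<xi> + t *\<^sub>R axis i 1)))\<^sup>2) \<partial>lborel)"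
proof -
  have [measurable]: "f \<in> borel_measurable borel"
    using borel_measurable_integrable[OF f] by simp
  let ?k = "\<lambda>t. ennreal \<bar>L * trapezoid_kernel (L * t)\<bar>"
  let ?g = "\<lambda>t. ennreal (cmod (fourier f (\<xi> + t *\<^sub>R axis i 1)))"
  note rep = fourier_line_representation[OF f supp L, of \<xi>]
  have "ennreal (cmod (fourier f \<xi>)) \<le> (\<integral>\<^sup>+t. ?k t * ?g t \<partial>lborel)"
  proof -
    have "ennreal (cmod (fourier f \<xi>)) \<le> (\<integral>\<^sup>+t. ennreal (cmod (complex_of_real (L * trapezoid_kernel (L * t)) *
        iexp (t * p) * fourier f (\<xi> + t *\<^sub>R axis i 1))) \<partial>lborel)"
      by (subst rep(2)) (rule integral_norm_bound_ennreal[OF rep(1)])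
    then show ?thesis
      by (simp add: norm_mult abs_mult flip: ennreal_mult)
  qed
  then have "(ennreal (cmod (fourier f \<xi>)))\<^sup>2 \<le> (\<integral>\<^sup>+t. ?k t * ?g t \<partial>lborel)\<^sup>2"
    by (rule power_mono) simp
  also have "\<dots> \<le> (\<integral>\<^sup>+t. ?k t ^ 2 \<partial>lborel) * (\<integral>\<^sup>+t. ?g t ^ 2 \<partial>lborel)"
    by (rule Cauchy_Schwarz_nn_integral) measurable
  also have "(\<integral>\<^sup>+t. ?k t ^ 2 \<partial>lborel) = (\<integral>\<^sup>+t. ennreal (L\<^sup>2 * (trapezoid_kernel (0 + L * t))\<^sup>2) \<partial>lborel)"
    by (simp add: ennreal_power power_mult_distrib)
  also have "\<dots> = ennreal (LINT t|lborel. L\<^sup>2 * (trapezoid_kernel (0 + L * t))\<^sup>2)"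
    using L lborel_integrable_real_affine[OF integrable_trapezoid_kernel_square, of L 0]
    by (intro nn_integral_eq_integral integrable_mult_right) auto
  also have "(LINT t|lborel. L\<^sup>2 * (trapezoid_kernel (0 + L * t))\<^sup>2) = L * kernel_energy"
    unfolding kernel_energy_def using L
    by (subst lborel_integral_real_affine[where c=L and t=0]) (auto simp: power2_eq_square)
  finally show ?thesis
    by (simp add: ennreal_power mult.commute)
qed

lemma nn_integral_lborel_translate:
  fixes g :: "'a::euclidean_space \<Rightarrow> ennreal"
  assumes [measurable]: "g \<in> borel_measurable borel"
  shows "(\<integral>\<^sup>+x. g (x + a) \<partial>lborel) = (\<integral>\<^sup>+x. g x \<partial>lborel)"
  by (subst lborel_distr_plus[of a, symmetric]) (simp add: nn_integral_distr add.commute)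

text \<open>Insert the line bound, apply Tonelli, and translate by \<open>t *\<^sub>R v\<close> so
  that the shift moves from \<open>g\<close> to the indicator of \<open>S\<close>. What then
  multiplies \<open>g \<zeta>\<close> is the length of the slice of \<open>S\<close> by the line
  through \<open>\<zeta>\<close>; hence the sign in \<open>thin\<close>.\<close>

lemma nn_integral_set_le_of_line_bound:
  fixes g :: "'a::euclidean_space \<Rightarrow> ennreal" and S :: "'a set"
  assumes [measurable]: "g \<in> borel_measurable borel" "S \<in> sets borel"
    and line: "\<And>\<xi>. g \<xi> \<le> c * (\<integral>\<^sup>+t. g (\<xi> + t *\<^sub>R v) \<partial>lborel)"
    and thin: "\<And>\<zeta>. emeasure lborel {t. \<zeta> - t *\<^sub>R v \<in> S} \<le> \<delta>"
  shows "(\<integral>\<^sup>+\<xi>. indicator S \<xi> * g \<xi> \<partial>lborel) \<le> c * \<delta> * (\<integral>\<^sup>+\<xi>. g \<xi> \<partial>lborel)"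
proof -
  have "(\<integral>\<^sup>+\<xi>. indicator S \<xi> * g \<xi> \<partial>lborel) \<le>
      (\<integral>\<^sup>+\<xi>. indicator S \<xi> * (c * (\<integral>\<^sup>+t. g (\<xi> + t *\<^sub>R v) \<partial>lborel)) \<partial>lborel)"
    by (intro nn_integral_mono mult_left_mono line) simp
  also have "\<dots> = c * (\<integral>\<^sup>+\<xi>. (\<integral>\<^sup>+t. indicator S \<xi> * g (\<xi> + t *\<^sub>R v) \<partial>lborel) \<partial>lborel)"
    by (simp add: nn_integral_cmult mult.left_commute)
  also have "(\<integral>\<^sup>+\<xi>. (\<integral>\<^sup>+t. indicator S \<xi> * g (\<xi> + t *\<^sub>R v) \<partial>lborel) \<partial>lborel) =
      (\<integral>\<^sup>+t. (\<integral>\<^sup>+\<xi>. indicator S \<xi> * g (\<xi> + t *\<^sub>R v) \<partial>lborel) \<partial>lborel)"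
    by (rule lborel_pair.Fubini'[symmetric]) measurable
  also have "\<dots> = (\<integral>\<^sup>+t. (\<integral>\<^sup>+\<zeta>. indicator S (\<zeta> - t *\<^sub>R v) * g \<zeta> \<partial>lborel) \<partial>lborel)"
  proof (rule nn_integral_cong)
    fix t :: real
    show "(\<integral>\<^sup>+\<xi>. indicator S \<xi> * g (\<xi> + t *\<^sub>R v) \<partial>lborel) = (\<integral>\<^sup>+\<zeta>. indicator S (\<zeta> - t *\<^sub>R v) * g \<zeta> \<partial>lborel)"
      by (subst (2) nn_integral_lborel_translate[of _ "t *\<^sub>R v", symmetric]) auto
  qed
  also have "\<dots> = (\<integral>\<^sup>+\<zeta>. (\<integral>\<^sup>+t. indicator S (\<zeta> - t *\<^sub>R v) * g \<zeta> \<partial>lborel) \<partial>lborel)"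
    by (rule lborel_pair.Fubini') measurable
  also have "\<dots> = (\<integral>\<^sup>+\<zeta>. emeasure lborel {t. \<zeta> - t *\<^sub>R v \<in> S} * g \<zeta> \<partial>lborel)"
  proof (rule nn_integral_cong)
    fix \<zeta> :: 'a
    have [measurable]: "{t. \<zeta> - t *\<^sub>R v \<in> S} \<in> sets borel"
      by measurable
    have "(\<integral>\<^sup>+t. indicator S (\<zeta> - t *\<^sub>R v) * g \<zeta> \<partial>lborel) =
        (\<integral>\<^sup>+t. indicator {t. \<zeta> - t *\<^sub>R v \<in> S} t * g \<zeta> \<partial>lborel)"
      by (intro nn_integral_cong) (auto simp: indicator_def)
    also have "\<dots> = (\<integral>\<^sup>+t. indicator {t. \<zeta> - t *\<^sub>R v \<in> S} t \<partial>lborel) * g \<zeta>"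
      by (rule nn_integral_multc) measurable
    also have "(\<integral>\<^sup>+t. indicator {t. \<zeta> - t *\<^sub>R v \<in> S} t \<partial>lborel) = emeasure lborel {t. \<zeta> - t *\<^sub>R v \<in> S}"
      by (rule nn_integral_indicator) measurable
    finally show "(\<integral>\<^sup>+t. indicator S (\<zeta> - t *\<^sub>R v) * g \<zeta> \<partial>lborel) = emeasure lborel {t. \<zeta> - t *\<^sub>R v \<in> S} * g \<zeta>" .
  qed
  also have "\<dots> \<le> (\<integral>\<^sup>+\<zeta>. \<delta> * g \<zeta> \<partial>lborel)"
    by (intro nn_integral_mono mult_right_mono thin) simp
  also have "\<dots> = \<delta> * (\<integral>\<^sup>+\<zeta>. g \<zeta> \<partial>lborel)"
    by (simp add: nn_integral_cmult)
  finally show ?thesis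
    by (simp add: mult.assoc mult_left_mono)
qed

section \<open>Sectors of the annulus\<close>

text \<open>The second condition says that coordinate \<open>i\<close> carries at least the average
  share of the squared norm. It keeps lines parallel to axis \<open>i\<close> uniformly transversal
  to the spheres about 0; a tangential line would meet the annulus in a length not of order
  \<open>w\<close>.\<close>

definition annulus_sector :: "real \<Rightarrow> real \<Rightarrow> 'd::finite \<Rightarrow> (real^'d) set" where
  "annulus_sector k w i = {\<xi>. \<bar>norm \<xi> - k\<bar> \<le> w \<and> (norm \<xi>)\<^sup>2 \<le> CARD('d) * (\<xi> $ i)\<^sup>2}"

lemma annulus_sector_measurable [measurable]: "annulus_sector k w i \<in> sets borel"
  unfolding annulus_sector_def by (intro borel_closed closed_Collect_conj closed_Collect_le continuous_intros)

text \<open>The squared coordinates sum to the squared norm, so some coordinate reaches the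
  average.\<close>

lemma annulus_subset_sectors: "{\<xi>. \<bar>norm \<xi> - k\<bar> \<le> w} \<subseteq> (\<Union>i. annulus_sector k w i)"
proof
  fix \<xi> :: "real^'d"
  assume \<xi>: "\<xi> \<in> {\<xi>. \<bar>norm \<xi> - k\<bar> \<le> w}"
  have "\<exists>i. (norm \<xi>)\<^sup>2 \<le> CARD('d) * (\<xi> $ i)\<^sup>2"
  proof (rule ccontr)
    assume "\<not> ?thesis"
    then have "(\<Sum>i\<in>UNIV. CARD('d) * (\<xi> $ i)\<^sup>2) < (\<Sum>i\<in>(UNIV::'d set). (norm \<xi>)\<^sup>2)"
      by (intro sum_strict_mono) (auto simp: not_le)
    moreover have "(norm \<xi>)\<^sup>2 = (\<Sum>i\<in>UNIV. (\<xi> $ i)\<^sup>2)"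
      by (simp add: norm_vec_def L2_set_def sum_nonneg)
    ultimately show False
      by (simp flip: sum_distrib_left)
  qed
  with \<xi> show "\<xi> \<in> (\<Union>i. annulus_sector k w i)"
    by (auto simp: annulus_sector_def)
qed

lemma subset_interval_of_pairwise_dist:
  fixes X :: "real set"
  assumes "\<And>x y. x \<in> X \<Longrightarrow> y \<in> X \<Longrightarrow> \<bar>x - y\<bar> \<le> \<delta>"
  shows "\<exists>a. X \<subseteq> {a - \<delta>..a + \<delta>}"
proof (cases "X = {}")
  case False
  then obtain a where "a \<in> X" by blast
  then show ?thesis
    using assms[of a] by (intro exI[of _ a]) (fastforce simp: abs_le_iff)
qed simp

lemma norm_power2_axis_shift:
  fixes \<zeta> :: "real^'d::finite"
  shows "(norm (\<zeta> - t *\<^sub>R axis i 1))\<^sup>2 - ((\<zeta> - t *\<^sub>R axis i 1) $ i)\<^sup>2 = (norm \<zeta>)\<^sup>2 - (\<zeta> $ i)\<^sup>2"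
proof -
  have "(norm (\<zeta> - t *\<^sub>R axis i 1))\<^sup>2 = (norm \<zeta>)\<^sup>2 - 2 * t * (\<zeta> $ i) + t\<^sup>2"
    unfolding power2_norm_eq_inner
    by (simp add: inner_diff_left inner_diff_right inner_axis inner_axis' power2_eq_square algebra_simps)
  moreover have "(\<zeta> - t *\<^sub>R axis i 1) $ i = \<zeta> $ i - t"
    by (simp add: axis_def)
  ultimately show ?thesis
    by (simp add: power2_eq_square algebra_simps)
qed

text \<open>The line may cross the annulus once on each side of \<open>?\<tau> t = 0\<close>, so the
  two signs are treated separately. On each side the radius varies by at most \<open>2 * w\<close>,
  and transversality costs a factor \<open>D\<close>.\<close>

lemma emeasure_annulus_sector_line:
  fixes \<zeta> :: "real^'d::finite"
  assumes w: "0 \<le> w" "w < k"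
  shows "emeasure lborel {t. \<zeta> - t *\<^sub>R axis i 1 \<in> annulus_sector k w i} \<le> ennreal (8 * sqrt CARD('d) * w)"
proof -
  define D where "D = sqrt CARD('d)"
  have D: "D > 0" "D\<^sup>2 = CARD('d)"
    by (simp_all add: D_def)
  define T where "T = {t. \<zeta> - t *\<^sub>R axis i 1 \<in> annulus_sector k w i}"
  let ?\<tau> = "\<lambda>t. \<zeta> $ i - t" and ?r = "\<lambda>t. norm (\<zeta> - t *\<^sub>R axis i 1)"
  have r: "\<bar>?r t - k\<bar> \<le> w" "?r t \<le> D * \<bar>?\<tau> t\<bar>" if "t \<in> T" for t
  proof -
    show "\<bar>?r t - k\<bar> \<le> w"
      using that by (simp add: T_def annulus_sector_def)
    have "(?r t)\<^sup>2 \<le> (D * \<bar>?\<tau> t\<bar>)\<^sup>2"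
      using that by (simp add: T_def annulus_sector_def D power_mult_distrib axis_def)
    then show "?r t \<le> D * \<bar>?\<tau> t\<bar>"
      using D by (intro power2_le_imp_le[of "?r t"]) auto
  qed
  \<comment> \<open>\<open>?r\<^sup>2 - ?\<tau>\<^sup>2\<close> is constant along the line, so a bound on the variation of \<open>?r\<close> bounds that of \<open>?\<tau>\<close>.\<close>
  have same_sign: "\<bar>t - t'\<bar> \<le> 2 * D * w" if "t \<in> T" "t' \<in> T" "\<bar>?\<tau> t + ?\<tau> t'\<bar> = \<bar>?\<tau> t\<bar> + \<bar>?\<tau> t'\<bar>" for t t'
  proof -
    \<comment> \<open>Since w < k, the annulus stays away from the origin, and this sum can be
      cancelled below.\<close>
    have pos: "?r t + ?r t' > 0"
      using r(1)[OF that(1)] r(1)[OF that(2)] w by linarith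
    have "(?r t)\<^sup>2 - (?r t')\<^sup>2 = (?\<tau> t)\<^sup>2 - (?\<tau> t')\<^sup>2"
      using norm_power2_axis_shift[of \<zeta> t i] norm_power2_axis_shift[of \<zeta> t' i] by (simp add: axis_def)
    then have "\<bar>(?r t - ?r t') * (?r t + ?r t')\<bar> = \<bar>(?\<tau> t - ?\<tau> t') * (?\<tau> t + ?\<tau> t')\<bar>"
      by (simp add: power2_eq_square algebra_simps)
    then have "\<bar>?r t - ?r t'\<bar> * (?r t + ?r t') = \<bar>t - t'\<bar> * (\<bar>?\<tau> t\<bar> + \<bar>?\<tau> t'\<bar>)"
      using pos that(3) by (simp add: abs_mult abs_minus_commute)
    moreover have "\<bar>t - t'\<bar> * (?r t + ?r t') \<le> \<bar>t - t'\<bar> * (D * (\<bar>?\<tau> t\<bar> + \<bar>?\<tau> t'\<bar>))"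
      using r(2)[OF that(1)] r(2)[OF that(2)] by (intro mult_left_mono) (auto simp: distrib_left)
    ultimately have "\<bar>t - t'\<bar> * (?r t + ?r t') \<le> D * \<bar>?r t - ?r t'\<bar> * (?r t + ?r t')"
      by (simp add: mult_ac)
    then have "\<bar>t - t'\<bar> \<le> D * \<bar>?r t - ?r t'\<bar>"
      using pos by (rule mult_right_le_imp_le)
    also have "\<dots> \<le> D * (2 * w)"
      using r(1)[OF that(1)] r(1)[OF that(2)] D by (intro mult_left_mono) auto
    finally show ?thesis
      by (simp add: mult_ac)
  qed
  \<comment> \<open>A set of diameter at most \<open>2 * D * w\<close> lies in an interval of twice
    that length, centred at any of its points; the two signs together give
    \<open>8 * D * w\<close>.\<close>
  obtain a where a: "{t \<in> T. ?\<tau> t \<ge> 0} \<subseteq> {a - 2 * D * w..a + 2 * D * w}"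
    using subset_interval_of_pairwise_dist[of "{t \<in> T. ?\<tau> t \<ge> 0}" "2 * D * w"] same_sign by auto
  obtain b where b: "{t \<in> T. ?\<tau> t \<le> 0} \<subseteq> {b - 2 * D * w..b + 2 * D * w}"
    using subset_interval_of_pairwise_dist[of "{t \<in> T. ?\<tau> t \<le> 0}" "2 * D * w"] same_sign by auto
  have "T \<subseteq> {a - 2 * D * w..a + 2 * D * w} \<union> {b - 2 * D * w..b + 2 * D * w}"
    using a b by fastforce
  then have "emeasure lborel T \<le> emeasure lborel ({a - 2 * D * w..a + 2 * D * w} \<union> {b - 2 * D * w..b + 2 * D * w})"
    by (intro emeasure_mono) auto
  also have "\<dots> \<le> emeasure lborel {a - 2 * D * w..a + 2 * D * w} + emeasure lborel {b - 2 * D * w..b + 2 * D * w}"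
    by (intro emeasure_subadditive) auto
  also have "\<dots> = ennreal (8 * D * w)"
    using D w by (simp flip: ennreal_plus)
  finally show ?thesis
    by (simp add: T_def D_def)
qed

section \<open>Fourier decay of test functions\<close>

lemma integral_lborel_translate:
  fixes g :: "'a::euclidean_space \<Rightarrow> 'b::{banach, second_countable_topology}"
  assumes [measurable]: "g \<in> borel_measurable borel"
  shows "(LINT x|lborel. g (x + a)) = (LINT x|lborel. g x)"
  by (subst lborel_distr_plus[of a, symmetric]) (simp add: integral_distr add.commute)

lemma integrable_continuous_compact_support:
  fixes g :: "'a::euclidean_space \<Rightarrow> complex"
  assumes "continuous_on UNIV g" "compact K" "{x. g x \<noteq> 0} \<subseteq> K"
  shows "integrable lborel g"
proof -
  have "integrable lborel (\<lambda>x. indicator K x *\<^sub>R g x)"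
    using assms by (intro borel_integrable_compact continuous_on_subset[OF assms(1)]) auto
  also have "(\<lambda>x. indicator K x *\<^sub>R g x) = g"
    using assms(3) by (auto simp: indicator_def fun_eq_iff)
  finally show ?thesis .
qed

text \<open>Average \<open>D\<close> over the shifts \<open>s *\<^sub>R v\<close> with s in [0, 1].
  By translation invariance and Fubini the integral is unchanged, while the fundamental theorem
  turns the average into \<open>\<psi> (x + v) - \<psi> x\<close>, whose integral is 0.\<close>

lemma integral_directional_derivative_eq_0:
  fixes \<psi> D :: "'a::euclidean_space \<Rightarrow> complex"
  assumes \<psi>: "integrable lborel \<psi>" and D: "integrable lborel D"
    and cont: "continuous_on UNIV D"
    and deriv: "\<And>x. ((\<lambda>t. \<psi> (x + t *\<^sub>R v)) has_vector_derivative D x) (at 0)"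
  shows "(LINT x|lborel. D x) = 0"
proof -
  have [measurable]: "D \<in> borel_measurable borel" "\<psi> \<in> borel_measurable borel"
    using \<psi> D by auto
  let ?G = "\<lambda>x s. indicator {0..1::real} s *\<^sub>R D (x + s *\<^sub>R v)"
  \<comment> \<open>The hypothesis differentiates only at parameter 0 but for every base point;
    moving the base point gives the derivative along the whole line.\<close>
  have deriv_at: "((\<lambda>t. \<psi> (x + t *\<^sub>R v)) has_vector_derivative D (x + s *\<^sub>R v)) (at s within A)" for x s A
  proof -
    have "((\<lambda>t. \<psi> ((x + s *\<^sub>R v) + t *\<^sub>R v)) has_vector_derivative D (x + s *\<^sub>R v)) (at (s - s))"
      using deriv[of "x + s *\<^sub>R v"] by simp
    from vector_diff_chain_at[of "\<lambda>t. t - s" 1 s, OF _ this]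
    have "((\<lambda>t. \<psi> (x + t *\<^sub>R v)) has_vector_derivative D (x + s *\<^sub>R v)) (at s)"
      by (simp add: o_def algebra_simps has_vector_derivative_diff_const)
    then show ?thesis
      by (rule has_vector_derivative_at_within)
  qed
  have FTC: "(LINT s|lborel. ?G x s) = \<psi> (x + 1 *\<^sub>R v) - \<psi> (x + 0 *\<^sub>R v)" for x
    by (rule integral_FTC_atLeastAtMost)
       (auto intro!: deriv_at continuous_on_compose2[OF cont] continuous_intros)
  have int_D: "integrable lborel (\<lambda>x. D (x + a))" for a
    using D by (subst (asm) lborel_distr_plus[of a, symmetric]) (simp add: integrable_distr_eq add.commute)
  have norm_D: "(LINT x|lborel. norm (D (x + a))) = (LINT x|lborel. norm (D x))" for a
    by (rule integral_lborel_translate) measurable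
  have "integrable (lborel \<Otimes>\<^sub>M lborel) (\<lambda>(s, x). ?G x s)"
  proof (rule lborel_pair.Fubini_integrable)
    show "integrable lborel (\<lambda>s. LINT x|lborel. norm ((\<lambda>(s, x). ?G x s) (s, x)))"
      by (simp add: norm_D)
  qed (use int_D in auto)
  then have "(LINT x|lborel. LINT s|lborel. ?G x s) = (LINT s|lborel. LINT x|lborel. ?G x s)"
    by (rule lborel_pair.Fubini_integral)
  also have "\<dots> = (LINT x|lborel. D x)"
    by (simp add: integral_lborel_translate)
  finally have "(LINT x|lborel. D x) = (LINT x|lborel. \<psi> (x + v) - \<psi> x)"
    by (simp add: FTC)
  also have "\<dots> = (LINT x|lborel. \<psi> (x + v)) - (LINT x|lborel. \<psi> x)"
  proof (rule Bochner_Integration.integral_diff[OF _ \<psi>])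
    show "integrable lborel (\<lambda>x. \<psi> (x + v))"
      using \<psi> by (subst (asm) lborel_distr_plus[of v, symmetric]) (simp add: integrable_distr_eq add.commute)
  qed
  also have "\<dots> = 0"
    by (simp add: integral_lborel_translate)
  finally show ?thesis .
qed

section \<open>Coordinate derivatives of test functions and their Fourier transforms\<close>

lemma iter_pdiff_pdiff: "iter_pdiff is (pdiff i f) = iter_pdiff (is @ [i]) f"
  by (induction "is") auto

lemma smooth_fun_pdiff: "smooth_fun f \<Longrightarrow> smooth_fun (pdiff i f)"
  unfolding smooth_fun_def iter_pdiff_pdiff by blast

lemma smooth_fun_continuous: "smooth_fun f \<Longrightarrow> continuous_on UNIV f"
  unfolding smooth_fun_def using iter_pdiff.simps(1)[of f] by (auto dest: spec[where x="[]"])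

lemma smooth_fun_has_pdiff:
  assumes "smooth_fun f"
  shows "((\<lambda>t. f (x + t *\<^sub>R axis i 1)) has_vector_derivative pdiff i f x) (at 0)"
proof -
  have "(\<lambda>t. iter_pdiff [] f (x + t *\<^sub>R axis i 1)) differentiable at 0"
    using assms unfolding smooth_fun_def by blast
  then show ?thesis
    by (simp add: pdiff_def vector_derivative_works)
qed

text \<open>Off the closed support \<open>f\<close> vanishes in a neighbourhood, so its derivative
  there exists and is 0.\<close>

lemma support_pdiff: "{x. pdiff i f x \<noteq> 0} \<subseteq> closure {x. f x \<noteq> 0}"
proof (rule ccontr)
  assume "\<not> ?thesis"
  then obtain x where x: "pdiff i f x \<noteq> 0" "x \<in> - closure {x. f x \<noteq> 0}"
    by blast
  have "((\<lambda>t. x + t *\<^sub>R axis i 1) \<longlongrightarrow> x) (at (0::real))"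
    by (auto intro!: tendsto_eq_intros)
  then have "\<forall>\<^sub>F t in at 0. x + t *\<^sub>R axis i (1::real) \<in> - closure {x. f x \<noteq> 0}"
    using x(2) by (intro topological_tendstoD) auto
  then have ev: "\<forall>\<^sub>F t in at 0. f (x + t *\<^sub>R axis i (1::real)) = 0"
    by eventually_elim (use closure_subset[of "{x. f x \<noteq> 0}"] in blast)
  have x0: "f x = 0"
    using x(2) closure_subset[of "{x. f x \<noteq> 0}"] by blast
  have "((\<lambda>t. f (x + t *\<^sub>R axis i 1)) has_vector_derivative 0) (at 0)"
    unfolding has_vector_derivative_def scaleR_zero_right
  proof (rule has_derivative_transform_eventually)
    show "((\<lambda>_. 0) has_derivative (\<lambda>_. 0)) (at 0)"
      by (rule has_derivative_const)
    show "\<forall>\<^sub>F t in at 0. 0 = f (x + t *\<^sub>R axis i (1::real))"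
      using ev by eventually_elim (rule sym)
    show "0 = f (x + 0 *\<^sub>R axis i (1::real))"
      using x0 by simp
  qed simp
  then have "pdiff i f x = 0"
    unfolding pdiff_def by (rule vector_derivative_at)
  with x(1) show False by simp
qed

lemma test_fun_pdiff:
  assumes "\<phi> \<in> test_fun \<Gamma>"
  shows "pdiff i \<phi> \<in> test_fun \<Gamma>"
proof -
  have "closure {x. pdiff i \<phi> x \<noteq> 0} \<subseteq> closure {x. \<phi> x \<noteq> 0}"
    by (rule closure_minimal[OF support_pdiff]) simp
  moreover from this have "compact (closure {x. pdiff i \<phi> x \<noteq> 0})"
    using assms closed_Int_compact[of "closure {x. pdiff i \<phi> x \<noteq> 0}" "closure {x. \<phi> x \<noteq> 0}"]
    by (simp add: test_fun_def Int_absorb2)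
  ultimately show ?thesis
    using assms by (auto simp: test_fun_def smooth_fun_pdiff)
qed

lemma test_fun_integrable:
  assumes "\<phi> \<in> test_fun \<Gamma>"
  shows "integrable lborel \<phi>"
proof (rule integrable_continuous_compact_support)
  show "{x. \<phi> x \<noteq> 0} \<subseteq> closure {x. \<phi> x \<noteq> 0}"
    by (rule closure_subset)
qed (use assms in \<open>auto simp: test_fun_def smooth_fun_continuous\<close>)

text \<open>Integration by parts: the derivative of the product of \<open>\<phi>\<close> and the
  exponential integrates to 0.\<close>

lemma fourier_pdiff:
  assumes \<phi>: "\<phi> \<in> test_fun \<Gamma>"
  shows "fourier (pdiff i \<phi>) \<xi> = \<i> * \<xi> $ i * fourier \<phi> \<xi>"
proof -
  let ?e = "\<lambda>x. exp (- \<i> * complex_of_real (\<xi> \<bullet> x))"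
  let ?D = "\<lambda>x. ?e x * pdiff i \<phi> x - \<i> * \<xi> $ i * (?e x * \<phi> x)"
  note \<phi>' = test_fun_pdiff[OF \<phi>, of i]
  have smooth: "smooth_fun \<phi>" "smooth_fun (pdiff i \<phi>)"
    using \<phi> \<phi>' by (auto simp: test_fun_def)
  note cont = smooth[THEN smooth_fun_continuous]
  have int: "integrable lborel (\<lambda>x. ?e x * f x)" if "f \<in> test_fun \<Gamma>" for f
    by (rule Bochner_Integration.integrable_bound[OF test_fun_integrable[OF that]])
       (use borel_measurable_integrable[OF test_fun_integrable[OF that]] in \<open>auto simp: norm_mult\<close>)
  have "(LINT x|lborel. ?D x) = 0"
  proof (rule integral_directional_derivative_eq_0[where \<psi>="\<lambda>x. ?e x * \<phi> x" and v="axis i 1"])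
    show "((\<lambda>t. ?e (x + t *\<^sub>R axis i 1) * \<phi> (x + t *\<^sub>R axis i 1)) has_vector_derivative ?D x) (at 0)" for x
    proof -
      have "((\<lambda>t. ?e (x + t *\<^sub>R axis i 1)) has_vector_derivative - \<i> * \<xi> $ i * ?e x) (at 0)"
        unfolding inner_add_right inner_scaleR_right inner_axis
        by (auto intro!: derivative_eq_intros simp: has_vector_derivative_complex_iff Re_exp Im_exp)
      from has_vector_derivative_mult[OF this smooth_fun_has_pdiff[OF smooth(1), of x i]]
      show ?thesis
        by (simp add: algebra_simps)
    qed
  qed (use int \<phi> \<phi>' in \<open>auto intro!: continuous_intros cont\<close>)
  also have "(LINT x|lborel. ?D x) = (LINT x|lborel. ?e x * pdiff i \<phi> x) - \<i> * \<xi> $ i * (LINT x|lborel. ?e x * \<phi> x)"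
    using int[OF \<phi>] int[OF \<phi>'] by (subst Bochner_Integration.integral_diff) auto
  finally show ?thesis
    by (simp add: fourier_def)
qed

lemma fourier_bounded:
  fixes f :: "real^'d::finite \<Rightarrow> complex"
  assumes "integrable lborel f"
  shows "\<exists>C. \<forall>\<xi>. cmod (fourier f \<xi>) \<le> C"
proof (intro exI allI)
  fix \<xi> :: "real^'d"
  have "cmod (LINT x|lborel. exp (- \<i> * complex_of_real (\<xi> \<bullet> x)) * f x) \<le> (LINT x|lborel. cmod (f x))"
    by (rule order_trans[OF integral_norm_bound]) (simp add: norm_mult)
  then show "cmod (fourier f \<xi>) \<le> (2 * pi) powr (- real CARD('d) / 2) * (LINT x|lborel. cmod (f x))"
    by (simp add: fourier_def norm_mult mult_left_mono)
qed

text \<open>Two derivatives along axis \<open>i\<close> gain the factor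
  \<open>(\<xi> $ i)\<^sup>2\<close>. The induction keeps \<open>\<phi>\<close> arbitrary, so its
  hypothesis applies both to \<open>\<phi>\<close> and to its second derivative. A product weight is
  chosen because its reciprocal is integrable one coordinate at a time.\<close>

lemma fourier_test_fun_decay:
  fixes \<phi> :: "real^'d::finite \<Rightarrow> complex"
  assumes "\<phi> \<in> test_fun \<Gamma>" "finite J"
  shows "\<exists>C. \<forall>\<xi>. (\<Prod>i\<in>J. 1 + (\<xi> $ i)\<^sup>2) * cmod (fourier \<phi> \<xi>) \<le> C"
  using assms(2,1)
proof (induction J arbitrary: \<phi> rule: finite_induct)
  case empty
  then show ?case
    using fourier_bounded[OF test_fun_integrable] by simp
next
  case (insert i J)
  let ?P = "\<lambda>\<xi>::real^'d. \<Prod>i\<in>J. 1 + (\<xi> $ i)\<^sup>2"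
  obtain C1 where C1: "\<And>\<xi>. ?P \<xi> * cmod (fourier \<phi> \<xi>) \<le> C1"
    using insert by blast
  obtain C2 where C2: "\<And>\<xi>. ?P \<xi> * cmod (fourier (pdiff i (pdiff i \<phi>)) \<xi>) \<le> C2"
    using insert test_fun_pdiff by blast
  have "cmod (fourier (pdiff i (pdiff i \<phi>)) \<xi>) = (\<xi> $ i)\<^sup>2 * cmod (fourier \<phi> \<xi>)" for \<xi>
    by (simp add: fourier_pdiff[OF insert.prems] fourier_pdiff[OF test_fun_pdiff[OF insert.prems]]
        norm_mult power2_eq_square)
  then have "(\<Prod>i\<in>insert i J. 1 + (\<xi> $ i)\<^sup>2) * cmod (fourier \<phi> \<xi>) \<le> C1 + C2" for \<xi>
    using C1[of \<xi>] C2[of \<xi>] insert.hyps by (simp add: algebra_simps)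
  then show ?case by blast
qed

text \<open>Expanding the product, only 1 and the single squares are kept; all other terms are
  nonnegative.\<close>

lemma one_plus_norm_square_le_prod:
  fixes \<xi> :: "real^'d::finite"
  shows "1 + (norm \<xi>)\<^sup>2 \<le> (\<Prod>i\<in>UNIV. 1 + (\<xi> $ i)\<^sup>2)"
proof -
  have "1 + (\<Sum>i\<in>J. (\<xi> $ i)\<^sup>2) \<le> (\<Prod>i\<in>J. 1 + (\<xi> $ i)\<^sup>2)" if "finite J" for J
    using that
  proof (induction J rule: finite_induct)
    case (insert i J)
    have "(1 + (\<Sum>i\<in>J. (\<xi> $ i)\<^sup>2)) * (1 + (\<xi> $ i)\<^sup>2) \<le> (\<Prod>i\<in>J. 1 + (\<xi> $ i)\<^sup>2) * (1 + (\<xi> $ i)\<^sup>2)"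
      by (intro mult_right_mono insert.IH) auto
    moreover have "0 \<le> (\<Sum>i\<in>J. (\<xi> $ i)\<^sup>2) * (\<xi> $ i)\<^sup>2"
      by (intro mult_nonneg_nonneg sum_nonneg) auto
    ultimately show ?case
      using insert.hyps by (simp add: algebra_simps)
  qed simp
  then show ?thesis
    by (simp add: norm_vec_def L2_set_def sum_nonneg)
qed

lemma integrable_inverse_prod_square:
  "integrable lborel (\<lambda>\<xi>::real^'d::finite. 1 / (\<Prod>i\<in>UNIV. 1 + (\<xi> $ i)\<^sup>2))"
proof (rule integrableI_nonneg)
  have Basis: "(Basis :: (real^'d) set) = range (\<lambda>i. axis i 1)"
    by (auto simp: Basis_vec_def)
  have "(\<integral>\<^sup>+\<xi>. ennreal (1 / (\<Prod>i\<in>UNIV. 1 + ((\<xi>::real^'d) $ i)\<^sup>2)) \<partial>lborel) =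
      (\<integral>\<^sup>+\<xi>. (\<Prod>b\<in>Basis. ennreal (1 / (1 + ((\<xi>::real^'d) \<bullet> b)\<^sup>2))) \<partial>lborel)"
    unfolding Basis
    by (subst prod.reindex) (auto simp: inj_on_def axis_eq_axis inner_axis prod_ennreal add_nonneg_nonneg prod_dividef)
  also have "\<dots> = (\<Prod>b\<in>(Basis::(real^'d) set). \<integral>\<^sup>+t. ennreal (1 / (1 + t\<^sup>2)) \<partial>lborel)"
    by (rule nn_integral_lborel_prod) auto
  also have "(\<integral>\<^sup>+t. ennreal (1 / (1 + (t::real)\<^sup>2)) \<partial>lborel) = ennreal (LINT t|lborel. 1 / (1 + t\<^sup>2))"
    by (rule nn_integral_eq_integral[OF integrable_inverse_square]) (simp add: add_nonneg_nonneg)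
  finally show "(\<integral>\<^sup>+\<xi>. ennreal (1 / (\<Prod>i\<in>UNIV. 1 + ((\<xi>::real^'d) $ i)\<^sup>2)) \<partial>lborel) < \<infinity>"
    by (simp add: ennreal_power less_top[symmetric])
qed (auto intro!: borel_measurable_continuous_onI continuous_intros AE_I2 prod_nonneg simp: add_nonneg_nonneg add_nonneg_eq_0_iff)

text \<open>Without this the limit in the definition of \<open>Htilde\<close> would be meaningless, since the Bochner
  integral \<open>hnorm2\<close> is 0 on functions of infinite norm.\<close>
lemma in_H_fourier_test_fun:
  fixes \<phi> :: "real^'d::finite \<Rightarrow> complex"
  assumes \<phi>: "\<phi> \<in> test_fun \<Gamma>" and s: "s \<le> 1"
  shows "in_H s (fourier \<phi>)"
  unfolding in_H_def
proof
  have [measurable]: "\<phi> \<in> borel_measurable borel"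
    using test_fun_integrable[OF \<phi>] by auto
  show "fourier \<phi> \<in> borel_measurable lborel"
    by simp
  obtain C where C: "\<And>\<xi>. (\<Prod>i\<in>UNIV. 1 + (\<xi> $ i)\<^sup>2) * cmod (fourier \<phi> \<xi>) \<le> C"
    using fourier_test_fun_decay[OF \<phi>, of UNIV] by auto
  let ?P = "\<lambda>\<xi>::real^'d. \<Prod>i\<in>UNIV. 1 + (\<xi> $ i)\<^sup>2"
  show "integrable lborel (\<lambda>\<xi>. (1 + (norm \<xi>)\<^sup>2) powr s * (cmod (fourier \<phi> \<xi>))\<^sup>2)"
  proof (rule Bochner_Integration.integrable_bound)
    show "integrable lborel (\<lambda>\<xi>. C\<^sup>2 * (1 / ?P \<xi>))"
      by (intro integrable_mult_right integrable_inverse_prod_square)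
    have bound: "(1 + (norm \<xi>)\<^sup>2) powr s * (cmod (fourier \<phi> \<xi>))\<^sup>2 \<le> C\<^sup>2 * (1 / ?P \<xi>)" for \<xi>
    proof -
      have P: "?P \<xi> > 0"
        by (intro prod_pos) (simp add: add_pos_nonneg)
      have "(1 + (norm \<xi>)\<^sup>2) powr s \<le> (1 + (norm \<xi>)\<^sup>2) powr 1"
        using s by (intro powr_mono) auto
      also have "\<dots> \<le> ?P \<xi>"
        using one_plus_norm_square_le_prod[of \<xi>] by (simp add: add_nonneg_nonneg)
      finally have "(1 + (norm \<xi>)\<^sup>2) powr s * (cmod (fourier \<phi> \<xi>))\<^sup>2 \<le> ?P \<xi> * (cmod (fourier \<phi> \<xi>))\<^sup>2"
        by (rule mult_right_mono) simp
      \<comment> \<open>One factor \<open>?P\<close> has absorbed the Sobolev weight; the squared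
        decay bound uses two, leaving the integrable \<open>1 / ?P\<close>.\<close>
      also have "\<dots> = (?P \<xi> * cmod (fourier \<phi> \<xi>))\<^sup>2 / ?P \<xi>"
        using P by (simp add: power2_eq_square)
      also have "\<dots> \<le> C\<^sup>2 / ?P \<xi>"
        using C[of \<xi>] P by (intro divide_right_mono power_mono) auto
      finally show ?thesis by simp
    qed
    show "AE \<xi> in lborel. norm ((1 + (norm \<xi>)\<^sup>2) powr s * (cmod (fourier \<phi> \<xi>))\<^sup>2) \<le> norm (C\<^sup>2 * (1 / ?P \<xi>))"
    proof (intro AE_I2)
      fix \<xi>
      have "norm ((1 + (norm \<xi>)\<^sup>2) powr s * (cmod (fourier \<phi> \<xi>))\<^sup>2) = (1 + (norm \<xi>)\<^sup>2) powr s * (cmod (fourier \<phi> \<xi>))\<^sup>2"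
        by simp
      also note bound[of \<xi>]
      also have "C\<^sup>2 * (1 / ?P \<xi>) \<le> norm (C\<^sup>2 * (1 / ?P \<xi>))"
        unfolding real_norm_def by (rule abs_ge_self)
      finally show "norm ((1 + (norm \<xi>)\<^sup>2) powr s * (cmod (fourier \<phi> \<xi>))\<^sup>2) \<le> norm (C\<^sup>2 * (1 / ?P \<xi>))" .
    qed
  qed measurable
qed

section \<open>The coercivity estimate\<close>

lemma in_H_measurable: "in_H s U \<Longrightarrow> U \<in> borel_measurable borel"
  by (simp add: in_H_def)

text \<open>The weights for different \<open>k\<close> are comparable, so \<open>in_H\<close>, which
  uses the weight for k = 1, makes every \<open>hnorm2 (1/2) k\<close> a genuine integral.\<close>

lemma in_H_half_weight:
  assumes U: "in_H (1/2) U"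
  shows "integrable lborel (\<lambda>\<xi>. sqrt (k\<^sup>2 + (norm \<xi>)\<^sup>2) * (cmod (U \<xi>))\<^sup>2)"
proof (rule Bochner_Integration.integrable_bound)
  note [measurable] = in_H_measurable[OF U]
  show "integrable lborel (\<lambda>\<xi>. (1 + \<bar>k\<bar>) * ((1 + (norm \<xi>)\<^sup>2) powr (1/2) * (cmod (U \<xi>))\<^sup>2))"
    using U by (simp add: in_H_def)
  show "(\<lambda>\<xi>. sqrt (k\<^sup>2 + (norm \<xi>)\<^sup>2) * (cmod (U \<xi>))\<^sup>2) \<in> borel_measurable lborel"
    by measurable
  have "sqrt (k\<^sup>2 + (norm \<xi>)\<^sup>2) \<le> (1 + \<bar>k\<bar>) * sqrt (1 + (norm \<xi>)\<^sup>2)" for \<xi> :: "real^'a"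
  proof -
    have "k\<^sup>2 + (norm \<xi>)\<^sup>2 \<le> (1 + \<bar>k\<bar>)\<^sup>2 * (1 + (norm \<xi>)\<^sup>2)"
      by (simp add: power2_sum algebra_simps)
    then have "sqrt (k\<^sup>2 + (norm \<xi>)\<^sup>2) \<le> sqrt ((1 + \<bar>k\<bar>)\<^sup>2 * (1 + (norm \<xi>)\<^sup>2))"
      by (rule real_sqrt_le_mono)
    then show ?thesis
      by (simp add: real_sqrt_mult)
  qed
  then show "AE \<xi> in lborel. norm (sqrt (k\<^sup>2 + (norm \<xi>)\<^sup>2) * (cmod (U \<xi>))\<^sup>2)
      \<le> norm ((1 + \<bar>k\<bar>) * ((1 + (norm \<xi>)\<^sup>2) powr (1/2) * (cmod (U \<xi>))\<^sup>2))"
    by (simp add: powr_half_sqrt add_nonneg_nonneg abs_mult mult_right_mono flip: mult.assoc)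
qed

lemma in_H_half_square:
  assumes U: "in_H (1/2) U"
  shows "integrable lborel (\<lambda>\<xi>. (cmod (U \<xi>))\<^sup>2)"
proof (rule Bochner_Integration.integrable_bound)
  note [measurable] = in_H_measurable[OF U]
  show "integrable lborel (\<lambda>\<xi>. sqrt (1\<^sup>2 + (norm \<xi>)\<^sup>2) * (cmod (U \<xi>))\<^sup>2)"
    by (rule in_H_half_weight[OF U])
  show "(\<lambda>\<xi>. (cmod (U \<xi>))\<^sup>2) \<in> borel_measurable lborel"
    by measurable
  have "(cmod (U \<xi>))\<^sup>2 \<le> sqrt (1\<^sup>2 + (norm \<xi>)\<^sup>2) * (cmod (U \<xi>))\<^sup>2" for \<xi>
    using mult_right_mono[of 1 "sqrt (1\<^sup>2 + (norm \<xi>)\<^sup>2)" "(cmod (U \<xi>))\<^sup>2"] by simp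
  then show "AE \<xi> in lborel. norm ((cmod (U \<xi>))\<^sup>2) \<le> norm (sqrt (1\<^sup>2 + (norm \<xi>)\<^sup>2) * (cmod (U \<xi>))\<^sup>2)"
    by (simp add: abs_mult)
qed

lemma cmod_add_square_le: "(cmod (a + b))\<^sup>2 \<le> 2 * (cmod a)\<^sup>2 + 2 * (cmod b)\<^sup>2"
proof -
  have "(cmod (a + b))\<^sup>2 \<le> (cmod a + cmod b)\<^sup>2"
    by (intro power_mono norm_triangle_ineq) simp
  also have "\<dots> \<le> 2 * (cmod a)\<^sup>2 + 2 * (cmod b)\<^sup>2"
    using zero_le_power2[of "cmod a - cmod b"] by (simp add: power2_eq_square algebra_simps)
  finally show ?thesis .
qed

lemma in_H_diff:
  assumes U: "in_H s U" and V: "in_H s V"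
  shows "in_H s (\<lambda>\<xi>. U \<xi> - V \<xi>)"
  unfolding in_H_def
proof
  note [measurable] = in_H_measurable[OF U] in_H_measurable[OF V]
  show "(\<lambda>\<xi>. U \<xi> - V \<xi>) \<in> borel_measurable lborel"
    by measurable
  let ?w = "\<lambda>\<xi>. (1 + (norm \<xi>)\<^sup>2) powr s"
  show "integrable lborel (\<lambda>\<xi>. ?w \<xi> * (cmod (U \<xi> - V \<xi>))\<^sup>2)"
  proof (rule Bochner_Integration.integrable_bound)
    show "integrable lborel (\<lambda>\<xi>. 2 * (?w \<xi> * (cmod (U \<xi>))\<^sup>2) + 2 * (?w \<xi> * (cmod (V \<xi>))\<^sup>2))"
      using U V by (simp add: in_H_def)
    have "?w \<xi> * (cmod (U \<xi> - V \<xi>))\<^sup>2 \<le> 2 * (?w \<xi> * (cmod (U \<xi>))\<^sup>2) + 2 * (?w \<xi> * (cmod (V \<xi>))\<^sup>2)" for \<xi>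
      using mult_left_mono[OF cmod_add_square_le[of "U \<xi>" "- V \<xi>"], of "?w \<xi>"] by (simp add: algebra_simps)
    then show "AE \<xi> in lborel. norm (?w \<xi> * (cmod (U \<xi> - V \<xi>))\<^sup>2) \<le>
        norm (2 * (?w \<xi> * (cmod (U \<xi>))\<^sup>2) + 2 * (?w \<xi> * (cmod (V \<xi>))\<^sup>2))"
      by simp
  qed measurable
qed

section \<open>The share of the mass carried by the annulus\<close>

definition annulus_const :: "real \<Rightarrow> real" where
  "annulus_const d = 8 * kernel_energy * d * sqrt d"

lemma annulus_const_nonneg: "d \<ge> 0 \<Longrightarrow> annulus_const d \<ge> 0"
  by (simp add: annulus_const_def kernel_energy_nonneg)

lemma nn_integral_annulus_test_fun:
  fixes \<phi> :: "real^'d::finite \<Rightarrow> complex"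
  assumes \<phi>: "\<phi> \<in> test_fun \<Gamma>" and \<Gamma>: "bounded \<Gamma>" "diameter \<Gamma> > 0" and w: "0 \<le> w" "w < k"
  shows "(\<integral>\<^sup>+\<xi>. indicator {\<xi>. \<bar>norm \<xi> - k\<bar> \<le> w} \<xi> * ennreal ((cmod (fourier \<phi> \<xi>))\<^sup>2) \<partial>lborel)
    \<le> ennreal (annulus_const CARD('d) * diameter \<Gamma> * w) * (\<integral>\<^sup>+\<xi>. ennreal ((cmod (fourier \<phi> \<xi>))\<^sup>2) \<partial>lborel)"
proof -
  let ?g = "\<lambda>\<xi>. ennreal ((cmod (fourier \<phi> \<xi>))\<^sup>2)"
  let ?L = "diameter \<Gamma>"
  have [measurable]: "\<phi> \<in> borel_measurable borel"
    using test_fun_integrable[OF \<phi>] by auto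
  \<comment> \<open>The diameter of the empty set is 0 by definition, so a positive diameter
    provides a point. The support then lies within distance \<open>?L\<close> of it, in each
    coordinate.\<close>
  obtain p where p: "p \<in> \<Gamma>"
    using \<Gamma>(2) by (force simp: diameter_def split: if_splits)
  have sector: "(\<integral>\<^sup>+\<xi>. indicator (annulus_sector k w i) \<xi> * ?g \<xi> \<partial>lborel) \<le>
      ennreal (kernel_energy * ?L) * ennreal (8 * sqrt CARD('d) * w) * (\<integral>\<^sup>+\<xi>. ?g \<xi> \<partial>lborel)" for i
  proof (rule nn_integral_set_le_of_line_bound[where v="axis i 1"])
    have "{x. \<phi> x \<noteq> 0} \<subseteq> {x. \<bar>x $ i - p $ i\<bar> \<le> ?L}"
    proof safe
      fix x assume "\<phi> x \<noteq> 0"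
      then have "x \<in> \<Gamma>"
        using \<phi> closure_subset[of "{x. \<phi> x \<noteq> 0}"] by (auto simp: test_fun_def)
      then have "dist x p \<le> ?L"
        using \<Gamma>(1) p by (intro diameter_bounded_bound)
      moreover have "\<bar>(x - p) $ i\<bar> \<le> norm (x - p)"
        by (rule component_le_norm_cart)
      ultimately show "\<bar>x $ i - p $ i\<bar> \<le> ?L"
        by (simp add: dist_norm)
    qed
    then show "?g \<xi> \<le> ennreal (kernel_energy * ?L) * (\<integral>\<^sup>+t. ?g (\<xi> + t *\<^sub>R axis i 1) \<partial>lborel)" for \<xi>
      by (rule fourier_line_bound[OF test_fun_integrable[OF \<phi>] _ \<Gamma>(2)])
  qed (use w emeasure_annulus_sector_line in auto)
  have "(\<integral>\<^sup>+\<xi>. indicator {\<xi>. \<bar>norm \<xi> - k\<bar> \<le> w} \<xi> * ?g \<xi> \<partial>lborel) \<le>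
      (\<integral>\<^sup>+\<xi>. (\<Sum>i\<in>UNIV. indicator (annulus_sector k w i) \<xi> * ?g \<xi>) \<partial>lborel)"
  proof (rule nn_integral_mono)
    fix \<xi> :: "real^'d"
    show "indicator {\<xi>. \<bar>norm \<xi> - k\<bar> \<le> w} \<xi> * ?g \<xi> \<le> (\<Sum>i\<in>UNIV. indicator (annulus_sector k w i) \<xi> * ?g \<xi>)"
    proof (cases "\<bar>norm \<xi> - k\<bar> \<le> w")
      case True
      then obtain i where i: "\<xi> \<in> annulus_sector k w i"
        using annulus_subset_sectors[of k w] by blast
      have "indicator (annulus_sector k w i) \<xi> * ?g \<xi> \<le> (\<Sum>i\<in>UNIV. indicator (annulus_sector k w i) \<xi> * ?g \<xi>)"
        by (rule member_le_sum) auto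
      then show ?thesis
        using True i by simp
    qed simp
  qed
  also have "\<dots> = (\<Sum>i\<in>UNIV. \<integral>\<^sup>+\<xi>. indicator (annulus_sector k w i) \<xi> * ?g \<xi> \<partial>lborel)"
    by (rule nn_integral_sum) measurable
  also have "\<dots> \<le> (\<Sum>i\<in>(UNIV::'d set). ennreal (kernel_energy * ?L) * ennreal (8 * sqrt CARD('d) * w) * (\<integral>\<^sup>+\<xi>. ?g \<xi> \<partial>lborel))"
    by (rule sum_mono) (rule sector)
  also have "\<dots> = ennreal CARD('d) * (ennreal (kernel_energy * ?L) * ennreal (8 * sqrt CARD('d) * w)) * (\<integral>\<^sup>+\<xi>. ?g \<xi> \<partial>lborel)"
    by (simp add: ennreal_of_nat_eq_real_of_nat mult.assoc)
  \<comment> \<open>The factors of \<open>annulus_const\<close>: one summand per sector,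
    \<open>kernel_energy\<close> from the line bound, and \<open>8 * sqrt CARD('d)\<close> from the
    slice length.\<close>
  also have "ennreal CARD('d) * (ennreal (kernel_energy * ?L) * ennreal (8 * sqrt CARD('d) * w)) =
      ennreal (annulus_const CARD('d) * ?L * w)"
    using w \<Gamma> by (simp add: annulus_const_def kernel_energy_nonneg mult_ac flip: ennreal_mult)
  finally show ?thesis .
qed

lemma integral_annulus_test_fun:
  fixes \<phi> :: "real^'d::finite \<Rightarrow> complex"
  assumes \<phi>: "\<phi> \<in> test_fun \<Gamma>" and \<Gamma>: "bounded \<Gamma>" "diameter \<Gamma> > 0" and w: "0 \<le> w" "w < k"
  shows "(LINT \<xi>|lborel. indicator {\<xi>. \<bar>norm \<xi> - k\<bar> \<le> w} \<xi> * (cmod (fourier \<phi> \<xi>))\<^sup>2)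
    \<le> annulus_const CARD('d) * diameter \<Gamma> * w * (LINT \<xi>|lborel. (cmod (fourier \<phi> \<xi>))\<^sup>2)"
proof -
  let ?A = "{\<xi>::real^'d. \<bar>norm \<xi> - k\<bar> \<le> w}"
  have [measurable]: "?A \<in> sets lborel"
    by measurable
  have int: "integrable lborel (\<lambda>\<xi>. (cmod (fourier \<phi> \<xi>))\<^sup>2)"
    by (rule in_H_half_square[OF in_H_fourier_test_fun[OF \<phi>]]) simp
  have "ennreal (LINT \<xi>|lborel. indicator ?A \<xi> * (cmod (fourier \<phi> \<xi>))\<^sup>2) =
      (\<integral>\<^sup>+\<xi>. indicator ?A \<xi> * ennreal ((cmod (fourier \<phi> \<xi>))\<^sup>2) \<partial>lborel)"
    using integrable_real_mult_indicator[of ?A lborel, OF _ int]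
    by (subst nn_integral_eq_integral[symmetric]) (auto simp: indicator_def mult.commute intro!: nn_integral_cong)
  also have "\<dots> \<le> ennreal (annulus_const CARD('d) * diameter \<Gamma> * w) * (\<integral>\<^sup>+\<xi>. ennreal ((cmod (fourier \<phi> \<xi>))\<^sup>2) \<partial>lborel)"
    by (rule nn_integral_annulus_test_fun[OF assms])
  also have "\<dots> = ennreal (annulus_const CARD('d) * diameter \<Gamma> * w * (LINT \<xi>|lborel. (cmod (fourier \<phi> \<xi>))\<^sup>2))"
    using \<Gamma> w by (simp add: nn_integral_eq_integral[OF int] ennreal_mult annulus_const_nonneg)
  finally show ?thesis
    using \<Gamma> w by (subst (asm) ennreal_le_iff) (auto intro!: mult_nonneg_nonneg annulus_const_nonneg)
qed

text \<open>Passage to the closure. The mass of \<open>U\<close> in the annulus is compared with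
  that of an approximant, and the total mass of the approximant with that of \<open>U\<close>; each
  comparison costs a factor 2, hence the 4. The error terms vanish in the limit.\<close>

lemma integral_annulus_Htilde:
  fixes U :: "real^'d::finite \<Rightarrow> complex"
  assumes U: "U \<in> Htilde (1/2) \<Gamma>" and \<Gamma>: "bounded \<Gamma>" "diameter \<Gamma> > 0" and w: "0 \<le> w" "w < k"
  shows "(LINT \<xi>|lborel. indicator {\<xi>. \<bar>norm \<xi> - k\<bar> \<le> w} \<xi> * (cmod (U \<xi>))\<^sup>2)
    \<le> 4 * (annulus_const CARD('d) * diameter \<Gamma> * w) * (LINT \<xi>|lborel. (cmod (U \<xi>))\<^sup>2)"
proof -
  let ?A = "{\<xi>::real^'d. \<bar>norm \<xi> - k\<bar> \<le> w}"
  let ?N = "\<lambda>V. LINT \<xi>|lborel. (cmod (V \<xi>))\<^sup>2" and ?NA = "\<lambda>V. LINT \<xi>|lborel. indicator ?A \<xi> * (cmod (V \<xi>))\<^sup>2"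
  define \<kappa> where "\<kappa> = annulus_const CARD('d) * diameter \<Gamma> * w"
  have \<kappa>: "\<kappa> \<ge> 0"
    using \<Gamma> w by (simp add: \<kappa>_def annulus_const_nonneg)
  have [measurable]: "?A \<in> sets lborel"
    by measurable
  obtain \<phi> where \<phi>: "\<And>j. \<phi> j \<in> test_fun \<Gamma>"
    and lim: "(\<lambda>j. hnorm2 (1/2) 1 (\<lambda>\<xi>. U \<xi> - fourier (\<phi> j) \<xi>)) \<longlonglongrightarrow> 0"
    and HU: "in_H (1/2) U"
    using U by (auto simp: Htilde_def)
  let ?V = "\<lambda>j. fourier (\<phi> j)"
  let ?\<delta> = "\<lambda>j. hnorm2 (1/2) 1 (\<lambda>\<xi>. U \<xi> - ?V j \<xi>)"
  have HV: "in_H (1/2) (?V j)" for j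
    by (rule in_H_fourier_test_fun[OF \<phi>]) simp
  note HD = in_H_diff[OF HU HV]
  note int = in_H_half_square
  have intA: "integrable lborel (\<lambda>\<xi>. indicator ?A \<xi> * (cmod (V \<xi>))\<^sup>2)" if "in_H (1/2) V" for V :: "real^'d \<Rightarrow> complex"
    using integrable_real_mult_indicator[of ?A lborel, OF _ int[OF that]] by (simp add: mult.commute)
  \<comment> \<open>The weight is at least 1, and \<open>HD\<close> makes the weighted integral
    genuine, so convergence in the Sobolev norm forces convergence in mean square.\<close>
  have \<delta>: "?N (\<lambda>\<xi>. U \<xi> - ?V j \<xi>) \<le> ?\<delta> j" for j
    unfolding hnorm2_def
  proof (rule integral_mono[OF int[OF HD]])
    show "integrable lborel (\<lambda>\<xi>. (1\<^sup>2 + (norm \<xi>)\<^sup>2) powr (1/2) * (cmod (U \<xi> - ?V j \<xi>))\<^sup>2)"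
      using HD[of j] by (simp add: in_H_def)
    show "(cmod (U \<xi> - ?V j \<xi>))\<^sup>2 \<le> (1\<^sup>2 + (norm \<xi>)\<^sup>2) powr (1/2) * (cmod (U \<xi> - ?V j \<xi>))\<^sup>2" for \<xi>
      using mult_right_mono[of 1 "sqrt (1\<^sup>2 + (norm \<xi>)\<^sup>2)" "(cmod (U \<xi> - ?V j \<xi>))\<^sup>2"]
      by (simp add: powr_half_sqrt add_nonneg_nonneg)
  qed
  have bound: "?NA U \<le> 4 * \<kappa> * ?N U + (4 * \<kappa> + 2) * ?\<delta> j" for j
  proof -
    have "?NA U \<le> (LINT \<xi>|lborel. 2 * (indicator ?A \<xi> * (cmod (?V j \<xi>))\<^sup>2) + 2 * (cmod (U \<xi> - ?V j \<xi>))\<^sup>2)"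
    proof (rule integral_mono[OF intA[OF HU]])
      show "integrable lborel (\<lambda>\<xi>. 2 * (indicator ?A \<xi> * (cmod (?V j \<xi>))\<^sup>2) + 2 * (cmod (U \<xi> - ?V j \<xi>))\<^sup>2)"
        using intA[OF HV] int[OF HD] by simp
      show "indicator ?A \<xi> * (cmod (U \<xi>))\<^sup>2 \<le> 2 * (indicator ?A \<xi> * (cmod (?V j \<xi>))\<^sup>2) + 2 * (cmod (U \<xi> - ?V j \<xi>))\<^sup>2" for \<xi>
        using cmod_add_square_le[of "?V j \<xi>" "U \<xi> - ?V j \<xi>"] by (simp add: indicator_def)
    qed
    also have "\<dots> = 2 * ?NA (?V j) + 2 * ?N (\<lambda>\<xi>. U \<xi> - ?V j \<xi>)"
      using intA[OF HV] int[OF HD] by simp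
    also have "?NA (?V j) \<le> \<kappa> * ?N (?V j)"
      unfolding \<kappa>_def by (rule integral_annulus_test_fun[OF \<phi> \<Gamma> w])
    also have "?N (?V j) \<le> (LINT \<xi>|lborel. 2 * (cmod (U \<xi>))\<^sup>2 + 2 * (cmod (U \<xi> - ?V j \<xi>))\<^sup>2)"
    proof (rule integral_mono[OF int[OF HV]])
      show "integrable lborel (\<lambda>\<xi>. 2 * (cmod (U \<xi>))\<^sup>2 + 2 * (cmod (U \<xi> - ?V j \<xi>))\<^sup>2)"
        using int[OF HU] int[OF HD] by simp
      show "(cmod (?V j \<xi>))\<^sup>2 \<le> 2 * (cmod (U \<xi>))\<^sup>2 + 2 * (cmod (U \<xi> - ?V j \<xi>))\<^sup>2" for \<xi>
        using cmod_add_square_le[of "U \<xi>" "?V j \<xi> - U \<xi>"] by (simp add: norm_minus_commute)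
    qed
    also have "\<dots> = 2 * ?N U + 2 * ?N (\<lambda>\<xi>. U \<xi> - ?V j \<xi>)"
      using int[OF HU] int[OF HD] by simp
    also have "2 * (\<kappa> * (2 * ?N U + 2 * ?N (\<lambda>\<xi>. U \<xi> - ?V j \<xi>))) + 2 * ?N (\<lambda>\<xi>. U \<xi> - ?V j \<xi>) =
        4 * \<kappa> * ?N U + (4 * \<kappa> + 2) * ?N (\<lambda>\<xi>. U \<xi> - ?V j \<xi>)"
      by (simp add: algebra_simps)
    also have "\<dots> \<le> 4 * \<kappa> * ?N U + (4 * \<kappa> + 2) * ?\<delta> j"
      using \<kappa> by (intro add_left_mono mult_left_mono \<delta>) auto
    finally show ?thesis
      using \<kappa> by (simp add: mult_left_mono)
  qed
  have "(\<lambda>j. 4 * \<kappa> * ?N U + (4 * \<kappa> + 2) * ?\<delta> j) \<longlonglongrightarrow> 4 * \<kappa> * ?N U + (4 * \<kappa> + 2) * 0"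
    by (intro tendsto_intros lim)
  then have "?NA U \<le> 4 * \<kappa> * ?N U + (4 * \<kappa> + 2) * 0"
    by (rule LIMSEQ_le_const) (use bound in auto)
  then show ?thesis
    by (simp add: \<kappa>_def)
qed

section \<open>Lower bounds for the symbol and for the form\<close>

lemma cmod_Zsym:
  assumes "k > 0"
  shows "cmod (Zsym k \<xi>) = sqrt \<bar>k\<^sup>2 - (norm \<xi>)\<^sup>2\<bar>"
    and "cmod (Zsym k \<xi>) = Re (Zsym k \<xi>) + Im (Zsym k \<xi>)"
proof -
  have "(norm \<xi>)\<^sup>2 \<le> k\<^sup>2 \<longleftrightarrow> norm \<xi> \<le> k"
    using assms abs_le_square_iff[of "norm \<xi>" k] by simp
  then show "cmod (Zsym k \<xi>) = sqrt \<bar>k\<^sup>2 - (norm \<xi>)\<^sup>2\<bar>"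
    and "cmod (Zsym k \<xi>) = Re (Zsym k \<xi>) + Im (Zsym k \<xi>)"
    by (auto simp: Zsym_def norm_mult)
qed

text \<open>\<open>Zsym\<close> is nonnegative real inside the ball of radius \<open>k\<close> and a
  nonnegative multiple of \<i> outside, so the two frequency ranges feed the real and the imaginary
  part of the integral separately and cannot cancel. The 4 is 2, from Re + Im \<le> 2 cmod, times 2,
  from the factor \<i> / 2 in \<open>aN\<close>.\<close>

lemma integral_cmod_Zsym_le_aN:
  fixes U :: "real^'d::finite \<Rightarrow> complex"
  assumes U: "in_H (1/2) U" and k: "k > 0"
  shows "integrable lborel (\<lambda>\<xi>. cmod (Zsym k \<xi>) * (cmod (U \<xi>))\<^sup>2)"
    and "(LINT \<xi>|lborel. cmod (Zsym k \<xi>) * (cmod (U \<xi>))\<^sup>2) \<le> 4 * cmod (aN k U U)"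
proof -
  note [measurable] = in_H_measurable[OF U]
  have [measurable]: "Zsym k \<in> borel_measurable (borel :: (real^'d) measure)"
    unfolding Zsym_def[abs_def] by measurable
  have Z_le: "cmod (Zsym k \<xi>) \<le> sqrt (k\<^sup>2 + (norm \<xi>)\<^sup>2)" for \<xi> :: "real^'d"
    unfolding cmod_Zsym(1)[OF k] by (rule real_sqrt_le_mono) (simp add: abs_le_iff)
  have int: "integrable lborel (\<lambda>\<xi>. Zsym k \<xi> * (cmod (U \<xi>))\<^sup>2)"
    by (rule Bochner_Integration.integrable_bound[OF in_H_half_weight[OF U, of k]])
       (auto simp: norm_mult abs_mult norm_power intro!: mult_right_mono Z_le)
  show "integrable lborel (\<lambda>\<xi>. cmod (Zsym k \<xi>) * (cmod (U \<xi>))\<^sup>2)"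
    using integrable_norm[OF int] by (simp add: norm_mult norm_power)
  let ?I = "LINT \<xi>|lborel. Zsym k \<xi> * (cmod (U \<xi>))\<^sup>2"
  have aN: "aN k U U = \<i> / 2 * ?I"
  proof -
    have "aN k U U = (LINT \<xi>|lborel. \<i> / 2 * (Zsym k \<xi> * (cmod (U \<xi>))\<^sup>2))"
      unfolding aN_def by (intro Bochner_Integration.integral_cong) (simp_all add: complex_norm_square mult_ac del: of_real_power)
    then show ?thesis
      by simp
  qed
  have "(LINT \<xi>|lborel. cmod (Zsym k \<xi>) * (cmod (U \<xi>))\<^sup>2) =
      (LINT \<xi>|lborel. Re (Zsym k \<xi> * (cmod (U \<xi>))\<^sup>2) + Im (Zsym k \<xi> * (cmod (U \<xi>))\<^sup>2))"
    by (intro Bochner_Integration.integral_cong) (simp_all add: cmod_Zsym(2)[OF k] distrib_right)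
  also have "\<dots> = Re ?I + Im ?I"
    unfolding integral_Re[OF int, symmetric] integral_Im[OF int, symmetric]
    by (rule Bochner_Integration.integral_add[OF integrable_Re[OF int] integrable_Im[OF int]])
  also have "\<dots> \<le> 2 * cmod ?I"
    using complex_Re_le_cmod[of ?I] abs_Im_le_cmod[of ?I] by linarith
  also have "\<dots> = 4 * cmod (aN k U U)"
    by (simp add: aN norm_mult)
  finally show "(LINT \<xi>|lborel. cmod (Zsym k \<xi>) * (cmod (U \<xi>))\<^sup>2) \<le> 4 * cmod (aN k U U)" .
qed

text \<open>With r the norm, the squared modulus of the symbol is \<bar>r - k\<bar> (r + k) and the
  squared weight is at most (r + k) squared, so comparing w (r + k) with \<bar>r - k\<bar> suffices.
  Up to r = 2 k use r + k \<le> 3 k and the distance \<open>w\<close>; beyond it r + k \<le> 3 (r -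
  k).\<close>

lemma cmod_Zsym_ge:
  fixes \<xi> :: "real^'d::finite"
  assumes w: "0 < w" "w \<le> k / 2" and far: "\<bar>norm \<xi> - k\<bar> > w"
  shows "sqrt (w / (3 * k)) * sqrt (k\<^sup>2 + (norm \<xi>)\<^sup>2) \<le> cmod (Zsym k \<xi>)"
proof -
  define r where "r = norm \<xi>"
  have k: "k > 0" and r: "r \<ge> 0"
    using w by (auto simp: r_def)
  have 1: "w * (r + k) \<le> 3 * k * \<bar>r - k\<bar>"
  proof (cases "r \<le> 2 * k")
    case True
    have "w * (r + k) \<le> w * (3 * k)"
      using True w by (intro mult_left_mono) auto
    also have "\<dots> \<le> \<bar>r - k\<bar> * (3 * k)"
      using far k by (intro mult_right_mono) (auto simp: r_def)
    finally show ?thesis by (simp add: mult_ac)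
  next
    case False
    have "w * (r + k) \<le> k * (3 * (r - k))"
      using False w k by (intro mult_mono) auto
    then show ?thesis
      using False k by (simp add: mult_ac)
  qed
  have "w * (k\<^sup>2 + r\<^sup>2) \<le> w * (r + k) * (r + k)"
    using w k r by (simp add: power2_eq_square algebra_simps)
  also have "\<dots> \<le> 3 * k * \<bar>r - k\<bar> * (r + k)"
    using k r by (intro mult_right_mono 1) auto
  also have "\<dots> = 3 * k * \<bar>k\<^sup>2 - r\<^sup>2\<bar>"
  proof -
    have "\<bar>k\<^sup>2 - r\<^sup>2\<bar> = \<bar>(r - k) * (r + k)\<bar>"
      by (simp add: power2_eq_square algebra_simps abs_minus_commute)
    then show ?thesis
      using k r by (simp add: abs_mult)
  qed
  finally have "w / (3 * k) * (k\<^sup>2 + r\<^sup>2) \<le> \<bar>k\<^sup>2 - r\<^sup>2\<bar>"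
    using k by (simp add: field_simps)
  then have "sqrt (w / (3 * k) * (k\<^sup>2 + r\<^sup>2)) \<le> sqrt \<bar>k\<^sup>2 - r\<^sup>2\<bar>"
    by (rule real_sqrt_le_mono)
  also have "sqrt \<bar>k\<^sup>2 - r\<^sup>2\<bar> = cmod (Zsym k \<xi>)"
    by (simp add: cmod_Zsym(1)[OF k] r_def)
  finally show ?thesis
    unfolding real_sqrt_mult r_def .
qed

lemma hnorm2_le_aN:
  fixes U :: "real^'d::finite \<Rightarrow> complex"
  assumes U: "in_H (1/2) U" and w: "0 < w" "w \<le> k / 2"
    and half: "2 * (LINT \<xi>|lborel. indicator {\<xi>. \<bar>norm \<xi> - k\<bar> \<le> w} \<xi> * (cmod (U \<xi>))\<^sup>2) \<le> (LINT \<xi>|lborel. (cmod (U \<xi>))\<^sup>2)"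
  shows "sqrt (w / (3 * k)) * hnorm2 (1/2) k U \<le> 12 * cmod (aN k U U)"
proof -
  let ?A = "{\<xi>::real^'d. \<bar>norm \<xi> - k\<bar> \<le> w}"
  let ?W = "\<lambda>\<xi>::real^'d. sqrt (k\<^sup>2 + (norm \<xi>)\<^sup>2)"
  define q where "q = sqrt (w / (3 * k))"
  have k: "k > 0"
    using w by simp
  have q: "q \<ge> 0"
    using w k by (simp add: q_def)
  have [measurable]: "?A \<in> sets lborel"
    by measurable
  note int = in_H_half_square[OF U] in_H_half_weight[OF U, of k] integral_cmod_Zsym_le_aN(1)[OF U k]
  have intA: "integrable lborel (\<lambda>\<xi>. indicator ?A \<xi> * (cmod (U \<xi>))\<^sup>2)"
    using integrable_real_mult_indicator[of ?A lborel, OF _ int(1)] by (simp add: mult.commute)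
  \<comment> \<open>The first summand is \<open>2 * k * q\<close> on the annulus, where
    \<open>?W\<close> is at most \<open>2 * k\<close>, and \<open>- 2 * k * q\<close> off it; its
    integral against the mass is nonpositive by \<open>half\<close>. Off the annulus both
    \<open>q * ?W\<close> and \<open>q * k\<close> are at most the modulus of the symbol, which
    accounts for the 3.\<close>
  have pointwise: "q * ?W \<xi> \<le> 2 * k * q * (2 * indicator ?A \<xi> - 1) + 3 * cmod (Zsym k \<xi>)" for \<xi>
  proof (cases "\<xi> \<in> ?A")
    case True
    then have "norm \<xi> \<le> 3/2 * k"
      using w by simp
    then have "(norm \<xi>)\<^sup>2 \<le> (3/2 * k)\<^sup>2"
      by (intro power_mono) auto
    then have "k\<^sup>2 + (norm \<xi>)\<^sup>2 \<le> (2 * k)\<^sup>2"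
      using zero_le_square[of k] unfolding power_mult_distrib power2_eq_square by linarith
    then have "?W \<xi> \<le> 2 * k"
      using k by (intro real_le_lsqrt) auto
    then have "q * ?W \<xi> \<le> q * (2 * k)"
      using q by (rule mult_left_mono)
    then show ?thesis
      using True by (simp add: mult_ac add_increasing2)
  next
    case False
    then have "q * ?W \<xi> \<le> cmod (Zsym k \<xi>)"
      unfolding q_def using w by (intro cmod_Zsym_ge) auto
    moreover have "q * k \<le> q * ?W \<xi>"
      using q k by (intro mult_left_mono real_le_rsqrt) auto
    ultimately show ?thesis
      using False by (simp add: mult_ac)
  qed
  have "q * hnorm2 (1/2) k U = (LINT \<xi>|lborel. q * (?W \<xi> * (cmod (U \<xi>))\<^sup>2))"
    by (simp add: hnorm2_def powr_half_sqrt add_nonneg_nonneg)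
  also have "\<dots> \<le> (LINT \<xi>|lborel. 2 * k * q * (2 * (indicator ?A \<xi> * (cmod (U \<xi>))\<^sup>2) - (cmod (U \<xi>))\<^sup>2)
      + 3 * (cmod (Zsym k \<xi>) * (cmod (U \<xi>))\<^sup>2))"
  proof (rule integral_mono)
    show "q * (?W \<xi> * (cmod (U \<xi>))\<^sup>2) \<le> 2 * k * q * (2 * (indicator ?A \<xi> * (cmod (U \<xi>))\<^sup>2) - (cmod (U \<xi>))\<^sup>2)
      + 3 * (cmod (Zsym k \<xi>) * (cmod (U \<xi>))\<^sup>2)" for \<xi>
      using mult_right_mono[OF pointwise[of \<xi>], of "(cmod (U \<xi>))\<^sup>2"] by (simp add: algebra_simps)
  qed (use int intA in auto)
  also have "\<dots> = 2 * k * q * (2 * (LINT \<xi>|lborel. indicator ?A \<xi> * (cmod (U \<xi>))\<^sup>2) - (LINT \<xi>|lborel. (cmod (U \<xi>))\<^sup>2))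
      + 3 * (LINT \<xi>|lborel. cmod (Zsym k \<xi>) * (cmod (U \<xi>))\<^sup>2)"
    using int intA by simp
  also have "\<dots> \<le> 0 + 3 * (4 * cmod (aN k U U))"
    using half k q integral_cmod_Zsym_le_aN(2)[OF U k]
    by (intro add_mono mult_nonneg_nonpos) auto
  finally show ?thesis
    by (simp add: q_def)
qed

theorem theorem1p6:
  fixes c0 :: real
  assumes dim: "CARD('d::finite) \<in> {1, 2}"
    and c0: "c0 > 0"
  shows "\<exists>C>0. \<forall>(\<Gamma>::(real^'d) set) k U.
           open \<Gamma> \<and> bounded \<Gamma> \<and> \<Gamma> \<noteq> {} \<and> k > 0 \<and> k * diameter \<Gamma> \<ge> c0 \<and> U \<in> Htilde (1/2) \<Gamma> \<longrightarrow>
           cmod (aN k U U) \<ge>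
             C * (k * diameter \<Gamma>) powr (if CARD('d) = 2 then - 2/3 else - 1/2) * hnorm2 (1/2) k U"
proof -
  define N where "N = annulus_const CARD('d)"
  \<comment> \<open>The annulus will have half-width \<open>\<theta> / diameter \<Gamma>\<close>.
    The first bound makes this at most \<open>k / 2\<close>; the second leaves at most half of the
    mass in the annulus. Adding 1 to \<open>N\<close> avoids division by 0.\<close>
  define \<theta> where "\<theta> = min (c0 / 2) (1 / (8 * (N + 1)))"
  \<comment> \<open>\<open>sqrt (\<theta> / 3)\<close> is the constant in
    \<open>sqrt (w / (3 * k))\<close>, 12 is the factor in \<open>hnorm2_le_aN\<close>, and the
    minimum pays for replacing the exponent -1/2 by -2/3.\<close>
  define C where "C = sqrt (\<theta> / 3) / 12 * min 1 (c0 powr (1/6))"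
  have N: "N \<ge> 0"
    by (simp add: N_def annulus_const_nonneg)
  have \<theta>: "\<theta> > 0" "\<theta> \<le> c0 / 2" "8 * N * \<theta> \<le> 1"
  proof -
    show "\<theta> > 0" "\<theta> \<le> c0 / 2"
      using c0 N by (auto simp: \<theta>_def)
    have "8 * N * \<theta> \<le> 8 * N * (1 / (8 * (N + 1)))"
      using N by (intro mult_left_mono) (auto simp: \<theta>_def)
    also have "\<dots> \<le> 1"
      using N by (simp add: divide_simps)
    finally show "8 * N * \<theta> \<le> 1" .
  qed
  have C: "C > 0"
    using \<theta> c0 by (simp add: C_def)
  have "C * (k * diameter \<Gamma>) powr (if CARD('d) = 2 then - 2/3 else - 1/2) * hnorm2 (1/2) k U \<le> cmod (aN k U U)"
    if \<Gamma>: "bounded \<Gamma>" and k: "k > 0" "k * diameter \<Gamma> \<ge> c0" and U: "U \<in> Htilde (1/2) \<Gamma>"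
    for \<Gamma> :: "(real^'d) set" and k U
  proof -
    let ?L = "diameter \<Gamma>"
    let ?\<beta> = "if CARD('d) = 2 then - 2/3 else - 1/2 :: real"
    have L: "?L > 0"
      using k c0 by (smt (verit) zero_less_mult_pos)
    define w where "w = \<theta> / ?L"
    have w: "0 < w" "w \<le> k / 2"
      using \<theta> L k by (auto simp: w_def field_simps)
    have "2 * (LINT \<xi>|lborel. indicator {\<xi>. \<bar>norm \<xi> - k\<bar> \<le> w} \<xi> * (cmod (U \<xi>))\<^sup>2) \<le>
        2 * (4 * (N * ?L * w) * (LINT \<xi>|lborel. (cmod (U \<xi>))\<^sup>2))"
      unfolding N_def using U \<Gamma> L w k(1) by (intro mult_left_mono integral_annulus_Htilde) auto
    also have "\<dots> = 8 * N * \<theta> * (LINT \<xi>|lborel. (cmod (U \<xi>))\<^sup>2)"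
      using L by (simp add: w_def)
    also have "\<dots> \<le> 1 * (LINT \<xi>|lborel. (cmod (U \<xi>))\<^sup>2)"
      by (intro mult_right_mono \<theta>) simp
    finally have half: "2 * (LINT \<xi>|lborel. indicator {\<xi>. \<bar>norm \<xi> - k\<bar> \<le> w} \<xi> * (cmod (U \<xi>))\<^sup>2) \<le> (LINT \<xi>|lborel. (cmod (U \<xi>))\<^sup>2)"
      by simp
    have "sqrt (w / (3 * k)) = sqrt (\<theta> / 3) * (k * ?L) powr (- 1/2)"
      using \<theta> L k by (simp add: w_def powr_minus powr_half_sqrt real_sqrt_divide real_sqrt_mult field_simps)
    \<comment> \<open>Since 1/6 - 2/3 = -1/2, the lower bound \<open>c0\<close> on
      \<open>k * ?L\<close> turns the stronger exponent into the stated one.\<close>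
    moreover have "min 1 (c0 powr (1/6)) * (k * ?L) powr ?\<beta> \<le> (k * ?L) powr (- 1/2)"
    proof (cases "CARD('d) = 2")
      case True
      have "min 1 (c0 powr (1/6)) * (k * ?L) powr ?\<beta> \<le> (k * ?L) powr (1/6) * (k * ?L) powr (- 2/3)"
        using True k c0 powr_mono2[of "1/6" c0 "k * ?L"] by (intro mult_mono) (auto intro: min.coboundedI2)
      also have "\<dots> = (k * ?L) powr (- 1/2)"
        by (simp flip: powr_add)
      finally show ?thesis .
    next
      case False
      then show ?thesis
        by (simp add: mult_left_le_one_le)
    qed
    ultimately have "12 * C * (k * ?L) powr ?\<beta> \<le> sqrt (w / (3 * k))"
      using \<theta> by (simp add: C_def mult.assoc mult_left_mono del: min_less_iff_conj)
    then have "12 * C * (k * ?L) powr ?\<beta> * hnorm2 (1/2) k U \<le> sqrt (w / (3 * k)) * hnorm2 (1/2) k U"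
      by (rule mult_right_mono) (auto simp: hnorm2_def)
    also have "\<dots> \<le> 12 * cmod (aN k U U)"
      using U w half by (intro hnorm2_le_aN) (auto simp: Htilde_def)
    finally show ?thesis
      by simp
  qed
  with C show ?thesis
    by blast
qed

end
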